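(* Let $G$ be an abelian group that is either mixed or torsion-free. Then every subgroup of $G$ is an essential subgroup of some direct summand of $G$ if, and only if, $G = D \oplus R$, where $D = T(D) \oplus D_0$ is a divisible group (with $T(D)$ its torsion subgroup and $D_0$ torsion-free) and $R$ is a homogeneous completely (fully) decomposable torsion-free group of finite rank. In particular, every such group $G$ is semi-generalized Bassian.
   Context: All groups are additively written abelian groups; a mixed group contains both non-zero elements of finite order and elements of infinite order; $T(A)$ denotes the torsion subgroup of $A$. A subgroup $H$ of a group $A$ is essential in $A$ if $H \cap S \neq \{0\}$ for every non-zero subgroup $S$ of $A$. A torsion-free group is fully decomposable if it is a direct sum of rank-one groups, and homogeneous if all its non-zero elements have the same type. A group $G$ is semi-generalized Bassian if, for every subgroup $H \le G$, the existence of an injective homomorphism $G \to G/H$ implies that $H$ is an essential subgroup of some direct summand of $G$. *)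

theory Defs
  imports Main "HOL-Library.Extended_Nat" "HOL-Computational_Algebra.Primes"
begin

text \<open>An abelian group is modelled as a type of class ab_group_add (the group is UNIV);
subgroups are subsets of that type.\<close>

primrec nmul :: "nat \<Rightarrow> 'a::ab_group_add \<Rightarrow> 'a" where
  "nmul 0 x = 0"
| "nmul (Suc n) x = x + nmul n x"

definition zmul :: "int \<Rightarrow> 'a::ab_group_add \<Rightarrow> 'a" where
  "zmul k x = (if 0 \<le> k then nmul (nat k) x else - nmul (nat (- k)) x)"

definition is_subgroup :: "'a::ab_group_add set \<Rightarrow> bool" where
  "is_subgroup H \<longleftrightarrow> 0 \<in> H \<and> (\<forall>x\<in>H. \<forall>y\<in>H. x - y \<in> H)"

definition has_finite_order :: "'a::ab_group_add \<Rightarrow> bool" where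
  "has_finite_order x \<longleftrightarrow> (\<exists>n>0. nmul n x = 0)"

definition torsion_part :: "'a::ab_group_add set \<Rightarrow> 'a set" where
  "torsion_part A = {x\<in>A. has_finite_order x}"

definition torsion_free :: "'a::ab_group_add set \<Rightarrow> bool" where
  "torsion_free A \<longleftrightarrow> (\<forall>x\<in>A. x \<noteq> 0 \<longrightarrow> \<not> has_finite_order x)"

definition mixed :: "'a::ab_group_add set \<Rightarrow> bool" where
  "mixed A \<longleftrightarrow> (\<exists>x\<in>A. x \<noteq> 0 \<and> has_finite_order x) \<and> (\<exists>x\<in>A. \<not> has_finite_order x)"

definition divisible :: "'a::ab_group_add set \<Rightarrow> bool" where
  "divisible A \<longleftrightarrow> (\<forall>x\<in>A. \<forall>n>0. \<exists>y\<in>A. nmul n y = x)"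

definition int_dsum :: "'a::ab_group_add set \<Rightarrow> 'a set \<Rightarrow> 'a set \<Rightarrow> bool" where
  "int_dsum A B C \<longleftrightarrow> is_subgroup B \<and> is_subgroup C \<and> B \<inter> C = {0} \<and>
     A = {b + c | b c. b \<in> B \<and> c \<in> C}"

definition direct_summand :: "'a::ab_group_add set \<Rightarrow> bool" where
  "direct_summand S \<longleftrightarrow> (\<exists>K. int_dsum UNIV S K)"

definition essential_in :: "'a::ab_group_add set \<Rightarrow> 'a set \<Rightarrow> bool" where
  "essential_in H A \<longleftrightarrow> H \<subseteq> A \<and>
     (\<forall>S. is_subgroup S \<and> S \<subseteq> A \<and> S \<noteq> {0} \<longrightarrow> H \<inter> S \<noteq> {0})"

definition internal_direct_sum :: "'a::ab_group_add set \<Rightarrow> 'a set set \<Rightarrow> bool" where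
  "internal_direct_sum R \<A> \<longleftrightarrow>
     (\<forall>A\<in>\<A>. is_subgroup A) \<and>
     R = {(\<Sum>A\<in>F. x A) | F x. finite F \<and> F \<subseteq> \<A> \<and> (\<forall>A\<in>F. x A \<in> A)} \<and>
     (\<forall>F x. finite F \<and> F \<subseteq> \<A> \<and> (\<forall>A\<in>F. x A \<in> A) \<and> (\<Sum>A\<in>F. x A) = 0
        \<longrightarrow> (\<forall>A\<in>F. x A = 0))"

definition z_independent :: "'a::ab_group_add set \<Rightarrow> bool" where
  "z_independent X \<longleftrightarrow> finite X \<and>
     (\<forall>c. (\<Sum>x\<in>X. zmul (c x) x) = 0 \<longrightarrow> (\<forall>x\<in>X. c x = 0))"

definition finite_rank :: "'a::ab_group_add set \<Rightarrow> bool" where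
  "finite_rank A \<longleftrightarrow> (\<exists>n. \<forall>X. X \<subseteq> A \<and> z_independent X \<longrightarrow> card X \<le> n)"

definition rank_one :: "'a::ab_group_add set \<Rightarrow> bool" where
  "rank_one A \<longleftrightarrow> is_subgroup A \<and> torsion_free A \<and> A \<noteq> {0} \<and>
     (\<forall>X. X \<subseteq> A \<and> z_independent X \<longrightarrow> card X \<le> 1)"

definition fully_decomposable :: "'a::ab_group_add set \<Rightarrow> bool" where
  "fully_decomposable R \<longleftrightarrow> torsion_free R \<and>
     (\<exists>\<A>. (\<forall>A\<in>\<A>. rank_one A) \<and> internal_direct_sum R \<A>)"

definition height :: "'a::ab_group_add set \<Rightarrow> nat \<Rightarrow> 'a \<Rightarrow> enat" where
  "height A p x = (SUP k\<in>{k. \<exists>y\<in>A. nmul (p ^ k) y = x}. enat k)"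

definition same_type :: "'a::ab_group_add set \<Rightarrow> 'a \<Rightarrow> 'a \<Rightarrow> bool" where
  "same_type A x y \<longleftrightarrow>
     finite {p. prime p \<and> height A p x \<noteq> height A p y} \<and>
     (\<forall>p. prime p \<and> height A p x \<noteq> height A p y \<longrightarrow> height A p x \<noteq> \<infinity> \<and> height A p y \<noteq> \<infinity>)"

definition homogeneous :: "'a::ab_group_add set \<Rightarrow> bool" where
  "homogeneous A \<longleftrightarrow> torsion_free A \<and>
     (\<forall>x\<in>A. \<forall>y\<in>A. x \<noteq> 0 \<and> y \<noteq> 0 \<longrightarrow> same_type A x y)"

definition cosets :: "'a::ab_group_add set \<Rightarrow> 'a set set" where
  "cosets H = {(\<lambda>h. x + h) ` H | x. True}"

definition set_add :: "'a::ab_group_add set \<Rightarrow> 'a set \<Rightarrow> 'a set" where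
  "set_add A B = {a + b | a b. a \<in> A \<and> b \<in> B}"

definition hom_to_quot :: "('a::ab_group_add \<Rightarrow> 'a set) \<Rightarrow> 'a set \<Rightarrow> bool" where
  "hom_to_quot f H \<longleftrightarrow> (\<forall>x. f x \<in> cosets H) \<and> (\<forall>x y. f (x + y) = set_add (f x) (f y))"

definition semi_generalized_bassian :: "'a::ab_group_add itself \<Rightarrow> bool" where
  "semi_generalized_bassian TYPE('a) \<longleftrightarrow>
     (\<forall>H::'a set. is_subgroup H \<and> (\<exists>f. hom_to_quot f H \<and> inj f)
        \<longrightarrow> (\<exists>S. direct_summand S \<and> essential_in H S))"

end

theory Submission
  imports Defs
begin

text \<open>
  Suppose every subgroup of \<open>G\<close> is essential in a summand. If \<open>s\<close> has infinite order and \<open>t\<close> is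
  torsion, splitting off a summand in which \<open>\<langle>n s + t\<rangle>\<close> is essential shows \<open>n\<close> divides \<open>t\<close> in the
  torsion subgroup, which is therefore divisible. Hence \<open>G = D \<oplus> R\<close> with \<open>D\<close> the largest divisible
  subgroup and \<open>R\<close> reduced, torsion-free, and such that every pure subgroup of \<open>R\<close> is a summand.
  Independent elements \<open>e 0, e 1, \<dots>\<close> of \<open>R\<close> cannot exist: modulo the pure hull of the elements
  \<open>e i - (i + 2) e (i + 1)\<close> the element \<open>e 0\<close> is non-zero and divisible by every integer. So splitting off
  pure subgroups of rank one stops after finitely many steps. If \<open>R = A \<oplus> C\<close>, \<open>x \<in> A\<close> and \<open>y \<in> C\<close>,
  the projections of \<open>y\<close> to the pure hulls of \<open>n x + y\<close> cannot vanish for all \<open>n\<close>, for then \<open>y\<close> would be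
  divisible by every \<open>n\<close>; a non-zero projection bounds the type of \<open>y\<close> by that of \<open>x\<close>.

  Conversely, in the rank-one summands of \<open>R\<close> choose elements with equal heights at all primes, and let
  \<open>F\<close> be the free group they generate. A pure subgroup \<open>B\<close> of \<open>R\<close> meets \<open>F\<close> in a summand of \<open>F\<close>, and
  the pure hull of a complement of \<open>B \<inter> F\<close> in \<open>F\<close> is a complement of \<open>B\<close> in \<open>R\<close>. A subgroup \<open>H\<close> of
  \<open>D \<oplus> R\<close> is essential in \<open>H + E\<close>, where \<open>E\<close> is the divisible hull of \<open>H \<inter> D\<close> in \<open>D\<close>; a complement of
  \<open>E\<close> in \<open>H + E\<close> lies in a complement of \<open>D\<close>, where its pure hull is a summand.
\<close>

section \<open>Subgroups and direct sums\<close>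

lemma nmul_add_left: "nmul (m + n) x = nmul m x + nmul n x"
  by (induction m) (auto simp: algebra_simps)

lemma nmul_add_right: "nmul n (x + y) = nmul n x + nmul n y"
  by (induction n) (auto simp: algebra_simps)

lemma nmul_mult: "nmul (m * n) x = nmul m (nmul n x)"
  by (induction m) (auto simp: nmul_add_left)

lemma nmul_diff_right: "nmul n (x - y) = nmul n x - nmul n y"
  by (induction n) (auto simp: algebra_simps)

lemma zmul_diff_nat: "zmul (int m - int n) x = nmul m x - nmul n x"
proof (cases "n \<le> m")
  case True
  then obtain k where "m = n + k" using le_Suc_ex by blast
  then show ?thesis by (simp add: zmul_def nmul_add_left)
next
  case False
  then obtain k where "n = m + k" "k > 0" using less_imp_add_positive[of m n] by auto
  then show ?thesis by (simp add: zmul_def nmul_add_left)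
qed

text \<open>An abelian group is a module over the integers, so \<open>zm.subspace\<close> and
  \<open>zm.span\<close> can serve for subgroups and generated subgroups. Writing integers as
  differences of naturals avoids sign cases in the module laws.\<close>

interpretation zm: module "zmul :: int \<Rightarrow> 'a::ab_group_add \<Rightarrow> 'a"
proof
  fix a b :: int and x y :: 'a
  obtain m n where a: "a = int m - int n" by (metis int_diff_cases)
  obtain k l where b: "b = int k - int l" by (metis int_diff_cases)
  show "zmul a (x + y) = zmul a x + zmul a y"
    by (simp add: a zmul_diff_nat nmul_add_right)
  have "a + b = int (m + k) - int (n + l)" by (simp add: a b)
  then show "zmul (a + b) x = zmul a x + zmul b x"
    by (simp only: zmul_diff_nat a b) (simp add: nmul_add_left)
  have eq: "a * b = int (m * k + n * l) - int (m * l + n * k)" by (simp add: a b algebra_simps)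
  show "zmul a (zmul b x) = zmul (a * b) x"
    unfolding eq unfolding a b zmul_diff_nat
    by (simp add: nmul_add_left nmul_mult nmul_diff_right)
  show "zmul 1 x = x" by (simp add: zmul_def)
qed

lemma nmul_eq_zmul: "nmul n x = zmul (int n) x"
  by (simp add: zmul_def)

lemma is_subgroup_iff: "is_subgroup H \<longleftrightarrow> zm.subspace H"
proof
  assume H: "is_subgroup H"
  have neg: "- x \<in> H" if "x \<in> H" for x
    using H that unfolding is_subgroup_def by (metis diff_0)
  have add: "x + y \<in> H" if "x \<in> H" "y \<in> H" for x y
    using H neg that unfolding is_subgroup_def by (metis diff_minus_eq_add)
  have "nmul n x \<in> H" if "x \<in> H" for n x
    using H that add by (induction n) (auto simp: is_subgroup_def)
  then show "zm.subspace H"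
    using H neg add unfolding zm.subspace_def zmul_def is_subgroup_def by auto
next
  assume "zm.subspace H"
  then show "is_subgroup H"
    by (simp add: is_subgroup_def zm.subspace_0 zm.subspace_diff)
qed

lemma has_finite_order_iff: "has_finite_order x \<longleftrightarrow> (\<exists>n. n \<noteq> 0 \<and> zmul n x = 0)"
proof
  assume "has_finite_order x"
  then show "\<exists>n. n \<noteq> 0 \<and> zmul n x = 0"
    unfolding has_finite_order_def nmul_eq_zmul by (metis of_nat_0_eq_iff less_irrefl)
next
  assume "\<exists>n. n \<noteq> 0 \<and> zmul n x = 0"
  then obtain n where "n \<noteq> 0" "zmul n x = 0" by blast
  then have "zmul (int (nat \<bar>n\<bar>)) x = 0" "nat \<bar>n\<bar> > 0" by (auto simp: abs_if)
  then show "has_finite_order x"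
    unfolding has_finite_order_def nmul_eq_zmul by blast
qed

lemma torsion_free_iff: "torsion_free A \<longleftrightarrow> (\<forall>x\<in>A. \<forall>n. n \<noteq> 0 \<longrightarrow> zmul n x = 0 \<longrightarrow> x = 0)"
  unfolding torsion_free_def has_finite_order_iff by blast

lemma torsion_freeD: "torsion_free A \<Longrightarrow> x \<in> A \<Longrightarrow> zmul n x = 0 \<Longrightarrow> n \<noteq> 0 \<Longrightarrow> x = 0"
  unfolding torsion_free_iff by blast

lemma torsion_free_cancel:
  assumes "torsion_free A" "zm.subspace A" "x \<in> A" "y \<in> A" "n \<noteq> 0" "zmul n x = zmul n y"
  shows "x = y"
  using torsion_freeD[OF assms(1), of "x - y" n] assms zm.subspace_diff[OF assms(2-4)]
  by (simp add: zm.scale_right_diff_distrib)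

lemma divisible_iff:
  assumes "zm.subspace A"
  shows "divisible A \<longleftrightarrow> (\<forall>x\<in>A. \<forall>n. n \<noteq> 0 \<longrightarrow> (\<exists>y\<in>A. zmul n y = x))"
proof
  assume A: "divisible A"
  show "\<forall>x\<in>A. \<forall>n. n \<noteq> 0 \<longrightarrow> (\<exists>y\<in>A. zmul n y = x)"
  proof (intro ballI allI impI)
    fix x and n :: int assume "x \<in> A" "n \<noteq> 0"
    then obtain y where y: "y \<in> A" "zmul (int (nat \<bar>n\<bar>)) y = x"
      using A unfolding divisible_def nmul_eq_zmul by (metis zero_less_abs_iff zero_less_nat_eq)
    show "\<exists>y\<in>A. zmul n y = x"
    proof (cases "n > 0")
      case True then show ?thesis using y by auto
    next
      case False then show ?thesis using y assms
        by (intro bexI[of _ "- y"]) (auto simp: zm.subspace_neg)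
    qed
  qed
next
  assume "\<forall>x\<in>A. \<forall>n. n \<noteq> 0 \<longrightarrow> (\<exists>y\<in>A. zmul n y = x)"
  then show "divisible A" unfolding divisible_def nmul_eq_zmul by auto
qed

lemma divisibleD:
  "divisible A \<Longrightarrow> zm.subspace A \<Longrightarrow> x \<in> A \<Longrightarrow> n \<noteq> 0 \<Longrightarrow> \<exists>y\<in>A. zmul n y = x"
  using divisible_iff by blast

lemma subspace_set_add:
  assumes "zm.subspace B" "zm.subspace C"
  shows "zm.subspace (set_add B C)"
  unfolding set_add_def
proof (rule zm.subspaceI)
  show "0 \<in> {b + c | b c. b \<in> B \<and> c \<in> C}"
    using zm.subspace_0[OF assms(1)] zm.subspace_0[OF assms(2)] by force
next
  fix x y assume "x \<in> {b + c | b c. b \<in> B \<and> c \<in> C}" "y \<in> {b + c | b c. b \<in> B \<and> c \<in> C}"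
  then obtain b c b' c' where *: "b \<in> B" "c \<in> C" "b' \<in> B" "c' \<in> C" "x = b + c" "y = b' + c'"
    by blast
  then have "x + y = (b + b') + (c + c')" by (simp add: algebra_simps)
  then show "x + y \<in> {b + c | b c. b \<in> B \<and> c \<in> C}"
    using * assms zm.subspace_add by blast
next
  fix x n assume "x \<in> {b + c | b c. b \<in> B \<and> c \<in> C}"
  then show "zmul n x \<in> {b + c | b c. b \<in> B \<and> c \<in> C}"
    using assms zm.subspace_scale zm.scale_right_distrib by blast
qed

section \<open>Internal direct sums and projections\<close>

lemma int_dsum_iff:
  "int_dsum A B C \<longleftrightarrow> zm.subspace B \<and> zm.subspace C \<and> B \<inter> C \<subseteq> {0} \<and> B \<subseteq> A \<and> C \<subseteq> A \<and>
     zm.subspace A \<and> (\<forall>x\<in>A. \<exists>b\<in>B. \<exists>c\<in>C. x = b + c)"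
proof
  assume *: "int_dsum A B C"
  then have B: "zm.subspace B" and C: "zm.subspace C" and A: "A = {b + c | b c. b \<in> B \<and> c \<in> C}"
    by (auto simp: int_dsum_def is_subgroup_iff)
  have "zm.subspace A" unfolding A by (rule subspace_set_add[OF B C, unfolded set_add_def])
  moreover have "B \<subseteq> A" "C \<subseteq> A" using A zm.subspace_0[OF B] zm.subspace_0[OF C] by force+
  ultimately show "zm.subspace B \<and> zm.subspace C \<and> B \<inter> C \<subseteq> {0} \<and> B \<subseteq> A \<and> C \<subseteq> A \<and>
     zm.subspace A \<and> (\<forall>x\<in>A. \<exists>b\<in>B. \<exists>c\<in>C. x = b + c)"
    using * A by (auto simp: int_dsum_def is_subgroup_iff)
next
  assume "zm.subspace B \<and> zm.subspace C \<and> B \<inter> C \<subseteq> {0} \<and> B \<subseteq> A \<and> C \<subseteq> A \<and>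
     zm.subspace A \<and> (\<forall>x\<in>A. \<exists>b\<in>B. \<exists>c\<in>C. x = b + c)"
  then show "int_dsum A B C"
    unfolding int_dsum_def is_subgroup_iff
    by (intro conjI) (auto simp: zm.subspace_0 intro: zm.subspace_add, blast)
qed

lemma int_dsumD:
  assumes "int_dsum A B C"
  shows "zm.subspace A" "zm.subspace B" "zm.subspace C" "B \<subseteq> A" "C \<subseteq> A"
    and "x \<in> B \<Longrightarrow> x \<in> C \<Longrightarrow> x = 0"
    and "x \<in> A \<Longrightarrow> \<exists>b\<in>B. \<exists>c\<in>C. x = b + c"
  using assms unfolding int_dsum_iff by auto

lemma int_dsum_unique:
  assumes "int_dsum A B C" "b \<in> B" "b' \<in> B" "c \<in> C" "c' \<in> C" "b + c = b' + c'"
  shows "b = b'" "c = c'"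
proof -
  have "b - b' = c' - c" using assms(6) by (simp add: algebra_simps)
  moreover have "b - b' \<in> B" "c' - c \<in> C"
    using assms int_dsumD(2,3)[OF assms(1)] by (auto simp: zm.subspace_diff)
  ultimately have "b - b' = 0" using int_dsumD(6)[OF assms(1)] by metis
  then show "b = b'" "c = c'" using assms(6) by auto
qed

lemma int_dsum_zero:
  assumes "int_dsum A B C" "b \<in> B" "c \<in> C" "b + c = 0"
  shows "b = 0" "c = 0"
  using int_dsum_unique[OF assms(1,2) _ assms(3), of 0 0] assms(4)
    zm.subspace_0[OF int_dsumD(2)[OF assms(1)]] zm.subspace_0[OF int_dsumD(3)[OF assms(1)]] by auto

lemma int_dsum_commute: "int_dsum A B C \<Longrightarrow> int_dsum A C B"
  unfolding int_dsum_iff by (metis add.commute inf.commute)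

text \<open>The modular law: the \<open>B\<close>-component of an element of \<open>U\<close> lies
  in \<open>U\<close>, hence so does the remaining \<open>C\<close>-component.\<close>

lemma int_dsum_modular:
  assumes "int_dsum A B C" "zm.subspace U" "B \<subseteq> U" "U \<subseteq> A"
  shows "int_dsum U B (U \<inter> C)"
  unfolding int_dsum_iff
proof (intro conjI ballI)
  fix x assume x: "x \<in> U"
  then obtain b c where bc: "b \<in> B" "c \<in> C" "x = b + c" using int_dsumD(7)[OF assms(1)] assms(4) by blast
  then have "c = x - b" by simp
  then have "c \<in> U" using x bc(1) assms(2,3) zm.subspace_diff[OF assms(2)] by blast
  then show "\<exists>b\<in>B. \<exists>c\<in>U \<inter> C. x = b + c" using bc by blast
qed (use assms int_dsumD[OF assms(1)] zm.subspace_inter in auto)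

text \<open>Unspecified outside the sum of \<open>B\<close> and \<open>C\<close>.\<close>

definition dproj :: "'a::ab_group_add set \<Rightarrow> 'a set \<Rightarrow> 'a \<Rightarrow> 'a" where
  "dproj B C x = (THE b. b \<in> B \<and> x - b \<in> C)"

lemma dproj_eqI:
  assumes "int_dsum A B C" "b \<in> B" "x - b \<in> C"
  shows "dproj B C x = b"
  unfolding dproj_def
proof (rule the_equality)
  fix b' assume "b' \<in> B \<and> x - b' \<in> C"
  then show "b' = b" using int_dsum_unique(1)[OF assms(1), of b' b "x - b'" "x - b"] assms by simp
qed (use assms in auto)

lemma dproj_in:
  assumes "int_dsum A B C" "x \<in> A"
  shows "dproj B C x \<in> B" "x - dproj B C x \<in> C"
proof -
  obtain b c where "b \<in> B" "c \<in> C" "x = b + c" using int_dsumD(7)[OF assms] by blast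
  then have "dproj B C x = b" "b \<in> B" "x - b \<in> C" using dproj_eqI[OF assms(1)] by auto
  then show "dproj B C x \<in> B" "x - dproj B C x \<in> C" by auto
qed

lemma dproj_id: "int_dsum A B C \<Longrightarrow> x \<in> B \<Longrightarrow> dproj B C x = x"
  by (rule dproj_eqI) (auto dest: int_dsumD(3) simp: zm.subspace_0)

lemma dproj_0: "int_dsum A B C \<Longrightarrow> x \<in> C \<Longrightarrow> dproj B C x = 0"
  by (rule dproj_eqI) (auto dest: int_dsumD(2) simp: zm.subspace_0)

lemma dproj_add:
  assumes "int_dsum A B C" "x \<in> A" "y \<in> A"
  shows "dproj B C (x + y) = dproj B C x + dproj B C y"
proof (rule dproj_eqI[OF assms(1)])
  show "dproj B C x + dproj B C y \<in> B"
    using dproj_in[OF assms(1)] assms int_dsumD(2)[OF assms(1)] by (auto intro: zm.subspace_add)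
  have "(x - dproj B C x) + (y - dproj B C y) \<in> C"
    using dproj_in[OF assms(1)] assms int_dsumD(3)[OF assms(1)] by (auto intro: zm.subspace_add)
  then show "x + y - (dproj B C x + dproj B C y) \<in> C" by (simp add: algebra_simps)
qed

lemma dproj_zmul:
  assumes "int_dsum A B C" "x \<in> A"
  shows "dproj B C (zmul n x) = zmul n (dproj B C x)"
proof (rule dproj_eqI[OF assms(1)])
  show "zmul n (dproj B C x) \<in> B"
    using dproj_in[OF assms] int_dsumD(2)[OF assms(1)] by (auto intro: zm.subspace_scale)
  have "zmul n (x - dproj B C x) \<in> C"
    using dproj_in[OF assms] int_dsumD(3)[OF assms(1)] by (auto intro: zm.subspace_scale)
  then show "zmul n x - zmul n (dproj B C x) \<in> C" by (simp add: zm.scale_right_diff_distrib)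
qed

text \<open>The generator is the least positive member, or 0 for the zero ideal. Later uses concern
  the multiples of an element that fall into a subgroup, and the coefficients with which a fixed
  generator occurs.\<close>

lemma int_ideal_principal:
  assumes "0 \<in> I" "\<And>a b. a \<in> I \<Longrightarrow> b \<in> I \<Longrightarrow> a - b \<in> I" "\<And>a k. a \<in> I \<Longrightarrow> k * a \<in> (I::int set)"
  obtains d where "d \<in> I" "\<And>m. m \<in> I \<Longrightarrow> d dvd m"
proof (cases "\<exists>n>0. int n \<in> I")
  case True
  define n where "n = (LEAST n. n > 0 \<and> int n \<in> I)"
  have n: "n > 0 \<and> int n \<in> I" unfolding n_def by (rule LeastI_ex[OF True])
  have "int n dvd m" if m: "m \<in> I" for m
  proof (rule ccontr)
    assume "\<not> int n dvd m"
    then have pos: "m mod int n > 0" using n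
      by (metis dvd_eq_mod_eq_0 of_nat_0_less_iff order_less_le pos_mod_sign)
    have "m mod int n = m - m div int n * int n" by (simp add: minus_div_mult_eq_mod)
    then have "m mod int n \<in> I" using assms(2,3) m n by simp
    then have "n \<le> nat (m mod int n)" unfolding n_def using pos by (intro Least_le) (simp add: n_def)
    moreover have "m mod int n < int n" using n by simp
    ultimately show False using pos by linarith
  qed
  then show ?thesis using that n by blast
next
  case False
  have "m = 0" if "m \<in> I" for m
  proof (rule ccontr)
    assume "m \<noteq> 0"
    moreover have "\<bar>m\<bar> \<in> I" using assms(3)[OF that, of "sgn m"] by (simp add: abs_sgn mult.commute)
    ultimately have "nat \<bar>m\<bar> > 0" "int (nat \<bar>m\<bar>) \<in> I" by auto
    then show False using False by blast
  qed
  then show ?thesis using that[of 0] assms(1) by blast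
qed

section \<open>Divisible and essential subgroups\<close>

lemma set_addI: "b \<in> B \<Longrightarrow> c \<in> C \<Longrightarrow> b + c \<in> set_add B C"
  unfolding set_add_def by blast

lemma set_addE:
  assumes "x \<in> set_add B C"
  obtains b c where "b \<in> B" "c \<in> C" "x = b + c"
  using assms unfolding set_add_def by blast

lemma subset_set_add:
  assumes "zm.subspace B" "zm.subspace C"
  shows "B \<subseteq> set_add B C" "C \<subseteq> set_add B C"
  using set_addI[of _ B 0 C] set_addI[of 0 B _ C] zm.subspace_0[OF assms(1)] zm.subspace_0[OF assms(2)]
  by force+

lemma int_dsum_set_add:
  assumes "zm.subspace B" "zm.subspace C" "B \<inter> C \<subseteq> {0}"
  shows "int_dsum (set_add B C) B C"
  unfolding int_dsum_iff using assms subspace_set_add subset_set_add[OF assms(1,2)]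
  by (auto elim!: set_addE)

lemma int_dsum_assoc:
  assumes "int_dsum A B C" "int_dsum B B1 B2"
  shows "int_dsum A B1 (set_add B2 C)"
  unfolding int_dsum_iff
proof (intro conjI ballI)
  note a = int_dsumD[OF assms(1)] and b = int_dsumD[OF assms(2)]
  show "zm.subspace B1" "zm.subspace A" "zm.subspace (set_add B2 C)" "B1 \<subseteq> A"
    using a b subspace_set_add by blast+
  show "set_add B2 C \<subseteq> A" using a(4,5) b(5) zm.subspace_add[OF a(1)] unfolding set_add_def by blast
  show "B1 \<inter> set_add B2 C \<subseteq> {0}"
  proof
    fix x assume "x \<in> B1 \<inter> set_add B2 C"
    then obtain y c where x: "x \<in> B1" "y \<in> B2" "c \<in> C" "x = y + c" by (auto elim: set_addE)
    have "x + 0 = y + c" using x by simp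
    then have "x = y" using int_dsum_unique(1)[OF assms(1), of x y 0 c] x b zm.subspace_0[OF a(3)] by blast
    then show "x \<in> {0}" using x b(6) by blast
  qed
  fix x assume "x \<in> A"
  then obtain y c where y: "y \<in> B" "c \<in> C" "x = y + c" using a(7) by blast
  then obtain y1 y2 where y2: "y1 \<in> B1" "y2 \<in> B2" "y = y1 + y2" using b(7) by blast
  have "x = y1 + (y2 + c)" using y y2 by (simp add: algebra_simps)
  then show "\<exists>b\<in>B1. \<exists>c\<in>set_add B2 C. x = b + c" using y y2 set_addI by blast
qed

lemma mem_span_insert:
  assumes "zm.subspace M"
  shows "y \<in> zm.span (insert x M) \<longleftrightarrow> (\<exists>k. y - zmul k x \<in> M)"
  unfolding zm.span_insert mem_Collect_eq zm.span_eq_iff[THEN iffD2, OF assms] ..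

section \<open>Complements of divisible subgroups\<close>

lemma subspace_Union_chain:
  assumes "\<C> \<noteq> {}" "subset.chain \<A> \<C>" "\<And>X. X \<in> \<A> \<Longrightarrow> zm.subspace X"
  shows "zm.subspace (\<Union>\<C>)"
proof -
  have sub: "zm.subspace X" if "X \<in> \<C>" for X
    using assms(2,3) that unfolding subset.chain_def by blast
  show ?thesis
  proof (rule zm.subspaceI)
    show "0 \<in> \<Union>\<C>" using assms(1) sub zm.subspace_0 by blast
  next
    fix x y assume "x \<in> \<Union>\<C>" "y \<in> \<Union>\<C>"
    then obtain X Y where XY: "X \<in> \<C>" "Y \<in> \<C>" "x \<in> X" "y \<in> Y" by blast
    then have "X \<subseteq> Y \<or> Y \<subseteq> X" using assms(2) unfolding subset.chain_def by blast
    then show "x + y \<in> \<Union>\<C>" using XY sub zm.subspace_add by (meson UnionI subset_iff)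
  next
    fix x n assume "x \<in> \<Union>\<C>"
    then show "zmul n x \<in> \<Union>\<C>" using sub zm.subspace_scale by blast
  qed
qed

text \<open>Take \<open>M\<close> maximal among the subgroups that contain \<open>H\<close> and meet
  \<open>D\<close> trivially. Given \<open>x\<close>, let \<open>n\<close> generate the ideal of all
  \<open>k\<close> with \<open>k x\<close> in \<open>D + M\<close>, and write
  \<open>n x = d + m\<close>. Divisibility gives \<open>d = n d'\<close>; every multiple of
  \<open>x - d'\<close> in \<open>D + M\<close> is then a multiple of \<open>m\<close>, and
  maximality puts \<open>x - d'\<close> into \<open>M\<close>.\<close>

lemma divisible_complement:
  assumes D: "zm.subspace D" "divisible D" and H: "zm.subspace H" "D \<inter> H \<subseteq> {0}"
  obtains M where "H \<subseteq> M" "int_dsum UNIV D M"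
proof -
  define \<A> where "\<A> = {M. zm.subspace M \<and> H \<subseteq> M \<and> D \<inter> M \<subseteq> {0}}"
  have "\<exists>M\<in>\<A>. \<forall>X\<in>\<A>. M \<subseteq> X \<longrightarrow> X = M"
  proof (rule subset_Zorn_nonempty)
    show "\<A> \<noteq> {}" using H by (auto simp: \<A>_def)
    fix \<C> assume *: "\<C> \<noteq> {}" "subset.chain \<A> \<C>"
    have "zm.subspace (\<Union>\<C>)" by (rule subspace_Union_chain[OF *]) (simp add: \<A>_def)
    moreover have "H \<subseteq> X" "D \<inter> X \<subseteq> {0}" if "X \<in> \<C>" for X
      using *(2) that unfolding subset.chain_def \<A>_def by auto
    then have "H \<subseteq> \<Union>\<C>" "D \<inter> \<Union>\<C> \<subseteq> {0}" using *(1) by blast+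
    ultimately show "\<Union>\<C> \<in> \<A>" unfolding \<A>_def by simp
  qed
  then obtain M where "M \<in> \<A>" and max: "\<And>X. X \<in> \<A> \<Longrightarrow> M \<subseteq> X \<Longrightarrow> X = M" by blast
  then have M: "zm.subspace M" "H \<subseteq> M" "D \<inter> M \<subseteq> {0}" unfolding \<A>_def by auto
  have DM: "zm.subspace (set_add D M)" by (rule subspace_set_add[OF D(1) M(1)])
  have subDM: "D \<subseteq> set_add D M" "M \<subseteq> set_add D M" by (rule subset_set_add[OF D(1) M(1)])+
  \<comment> \<open>If \<open>y\<close> in \<open>D\<close> has \<open>y - k x\<close> in
    \<open>M\<close>, then \<open>k x\<close> is in \<open>D + M\<close>, hence in \<open>M\<close>,
    so \<open>y\<close> is in \<open>D \<inter> M\<close>. Adjoining \<open>x\<close> to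
    \<open>M\<close> thus keeps the intersection with \<open>D\<close> trivial.\<close>
  have absorb: "x \<in> M" if *: "\<And>k. zmul k x \<in> set_add D M \<Longrightarrow> zmul k x \<in> M" for x
  proof -
    let ?X = "zm.span (insert x M)"
    have MX: "M \<subseteq> ?X" by (meson insert_subset order_trans subset_insertI zm.span_superset)
    have "?X \<in> \<A>" unfolding \<A>_def
    proof (intro CollectI conjI subsetI)
      show "zm.subspace ?X" by simp
      show "y \<in> ?X" if "y \<in> H" for y using that M(2) MX by blast
      fix y assume y: "y \<in> D \<inter> ?X"
      then obtain k where k: "y - zmul k x \<in> M" using mem_span_insert[OF M(1)] by blast
      have "y - (y - zmul k x) \<in> set_add D M"
        using y k subDM zm.subspace_diff[OF DM] by blast
      then have "zmul k x \<in> M" using * by simp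
      then have "y - zmul k x + zmul k x \<in> M" using k M(1) zm.subspace_add by blast
      then show "y \<in> {0}" using y M(3) by auto
    qed
    then have "?X = M" using max MX by blast
    then show "x \<in> M" by (metis insertI1 zm.span_base)
  qed
  have "x \<in> set_add D M" for x
  proof -
    define I where "I = {k. zmul k x \<in> set_add D M}"
    obtain n where n: "n \<in> I" "\<And>k. k \<in> I \<Longrightarrow> n dvd k"
    proof (rule int_ideal_principal[of I])
      show "0 \<in> I" using zm.subspace_0[OF DM] by (simp add: I_def)
      show "a - b \<in> I" if "a \<in> I" "b \<in> I" for a b
        using that zm.subspace_diff[OF DM] by (simp add: I_def zm.scale_left_diff_distrib)
      show "k * a \<in> I" if "a \<in> I" for a k
      proof -
        have "zmul k (zmul a x) \<in> set_add D M" using that zm.subspace_scale[OF DM] by (simp only: I_def mem_Collect_eq)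
        then show ?thesis by (simp add: I_def)
      qed
    qed blast
    obtain d m where dm: "d \<in> D" "m \<in> M" "zmul n x = d + m"
      using n(1) unfolding I_def by (auto elim: set_addE)
    have "\<exists>d'\<in>D. zmul n d' = d"
    \<comment> \<open>For \<open>n = 0\<close> the equation \<open>d + m = 0\<close> puts
      \<open>d\<close> into \<open>D \<inter> M\<close>, so \<open>d = 0\<close>.\<close>
    proof (cases "n = 0")
      case True
      then have "d = - m" using dm(3) by (simp add: eq_neg_iff_add_eq_0)
      then have "d \<in> M" using dm(2) zm.subspace_neg[OF M(1)] by blast
      then show ?thesis using True dm(1) M(3) by auto
    qed (use divisibleD[OF D(2,1) dm(1)] in blast)
    then obtain d' where d': "d' \<in> D" "zmul n d' = d" by blast
    have nx: "zmul n (x - d') = m" using dm d' by (simp add: zm.scale_right_diff_distrib)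
    have "x - d' \<in> M"
    proof (rule absorb)
      fix k assume "zmul k (x - d') \<in> set_add D M"
      moreover have "zmul k d' \<in> set_add D M" using zm.subspace_scale[OF D(1) d'(1)] subDM(1) by blast
      ultimately have "zmul k (x - d') + zmul k d' \<in> set_add D M" by (rule zm.subspace_add[OF DM])
      then have "n dvd k" by (intro n(2)) (simp add: I_def zm.scale_right_diff_distrib)
      then obtain j where "k = j * n" by (metis dvdE mult.commute)
      then have "zmul k (x - d') = zmul j m" using nx by (metis zm.scale_scale)
      then show "zmul k (x - d') \<in> M" using zm.subspace_scale[OF M(1) dm(2)] by simp
    qed
    then have "d' + (x - d') \<in> set_add D M" using d'(1) by (intro set_addI)
    then show ?thesis by simp
  qed
  then have "set_add D M = UNIV" by blast
  then show ?thesis using that M int_dsum_set_add[OF D(1) M(1,3)] by metis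
qed

section \<open>Essential subgroups and divisible hulls\<close>

lemma essential_in_iff:
  assumes "zm.subspace H" "zm.subspace A"
  shows "essential_in H A \<longleftrightarrow> H \<subseteq> A \<and> (\<forall>x\<in>A. x \<noteq> 0 \<longrightarrow> (\<exists>k. zmul k x \<in> H \<and> zmul k x \<noteq> 0))"
proof
  assume *: "essential_in H A"
  show "H \<subseteq> A \<and> (\<forall>x\<in>A. x \<noteq> 0 \<longrightarrow> (\<exists>k. zmul k x \<in> H \<and> zmul k x \<noteq> 0))"
  proof (intro conjI ballI impI)
    show "H \<subseteq> A" using * by (simp add: essential_in_def)
    fix x assume x: "x \<in> A" "x \<noteq> 0"
    have "zm.span {x} \<subseteq> A" using x(1) assms(2) by (intro zm.span_minimal) auto
    moreover have "zm.span {x} \<noteq> {0}" using x(2) zm.span_base[of x "{x}"] by auto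
    ultimately have "H \<inter> zm.span {x} \<noteq> {0}"
      using * unfolding essential_in_def is_subgroup_iff by simp
    moreover have "0 \<in> H \<inter> zm.span {x}" using zm.subspace_0[OF assms(1)] zm.span_zero by blast
    ultimately obtain y where "y \<in> H" "y \<in> zm.span {x}" "y \<noteq> 0" by blast
    then show "\<exists>k. zmul k x \<in> H \<and> zmul k x \<noteq> 0" unfolding zm.span_singleton by blast
  qed
next
  assume *: "H \<subseteq> A \<and> (\<forall>x\<in>A. x \<noteq> 0 \<longrightarrow> (\<exists>k. zmul k x \<in> H \<and> zmul k x \<noteq> 0))"
  show "essential_in H A" unfolding essential_in_def is_subgroup_iff
  proof (intro conjI allI impI)
    show "H \<subseteq> A" using * by blast
    fix S assume S: "zm.subspace S \<and> S \<subseteq> A \<and> S \<noteq> {0}"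
    then obtain x where x: "x \<in> S" "x \<noteq> 0" using zm.subspace_0 by blast
    then obtain k where "zmul k x \<in> H" "zmul k x \<noteq> 0" using * S by blast
    moreover have "zmul k x \<in> S" using S x(1) zm.subspace_scale by blast
    ultimately show "H \<inter> S \<noteq> {0}" by blast
  qed
qed

lemma essential_inD:
  assumes "essential_in H A" "zm.subspace H" "zm.subspace A" "x \<in> A"
  obtains k where "k \<noteq> 0" "zmul k x \<in> H" "x \<noteq> 0 \<Longrightarrow> zmul k x \<noteq> 0"
proof (cases "x = 0")
  case True
  then have "zmul 1 x \<in> H" using zm.subspace_0[OF assms(2)] by simp
  then show ?thesis using that[of 1] by simp
next
  case False
  then obtain k where k: "zmul k x \<in> H" "zmul k x \<noteq> 0"
    using assms essential_in_iff[OF assms(2,3)] by blast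
  then have "k \<noteq> 0" by (metis zm.scale_zero_left)
  then show ?thesis using that k by blast
qed

text \<open>One prime factor is divided out at a time. Prime divisors are what the Bezout argument
  in \<open>divisible_hull\<close> can treat.\<close>

lemma divisible_of_primes:
  assumes "\<And>x p. x \<in> A \<Longrightarrow> prime p \<Longrightarrow> \<exists>y\<in>A. zmul (int p) y = x"
  shows "divisible A"
proof -
  have "\<exists>y\<in>A. nmul n y = x" if "n > 0" "x \<in> A" for n x
    using that
  proof (induction n arbitrary: x rule: less_induct)
    case (less n)
    show ?case
    proof (cases "n = 1")
      case True then show ?thesis using less by (intro bexI[of _ x]) auto
    next
      case False
      then obtain p m where p: "prime p" "n = p * m" by (metis prime_factor_nat dvdE)
      then have "m < n" "m > 0" using less.prems prime_gt_1_nat[of p] by auto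
      obtain z where z: "z \<in> A" "zmul (int p) z = x" using assms less.prems p by blast
      obtain y where "y \<in> A" "nmul m y = z" using less.IH[OF \<open>m < n\<close> \<open>m > 0\<close> z(1)] by blast
      then show ?thesis using z p by (auto simp: nmul_mult nmul_eq_zmul)
    qed
  qed
  then show ?thesis unfolding divisible_def by blast
qed

text \<open>Take \<open>E\<close> maximal among the essential extensions of \<open>X\<close> inside
  \<open>D\<close>. If a \<open>p\<close>-th part \<open>y\<close> of an element of \<open>E\<close>
  lies outside \<open>E\<close>, adjoining it destroys essentiality. A witness \<open>z\<close> of
  this failure is killed by \<open>p\<close>, and subtracting a multiple of \<open>z\<close> from
  \<open>y\<close> gives a \<open>p\<close>-th part inside \<open>E\<close>.\<close>

lemma divisible_hull:
  assumes D: "zm.subspace D" "divisible D" and X: "zm.subspace X" "X \<subseteq> D"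
  obtains E where "zm.subspace E" "divisible E" "E \<subseteq> D" "essential_in X E"
proof -
  define \<A> where "\<A> = {E. zm.subspace E \<and> E \<subseteq> D \<and> X \<subseteq> E \<and>
    (\<forall>x\<in>E. x \<noteq> 0 \<longrightarrow> (\<exists>k. zmul k x \<in> X \<and> zmul k x \<noteq> 0))}"
  have "\<exists>M\<in>\<A>. \<forall>X\<in>\<A>. M \<subseteq> X \<longrightarrow> X = M"
  proof (rule subset_Zorn_nonempty)
    have "\<exists>k. zmul k x \<in> X \<and> zmul k x \<noteq> 0" if "x \<in> X" "x \<noteq> 0" for x
      using that by (intro exI[of _ 1]) auto
    then show "\<A> \<noteq> {}" using X by (auto simp: \<A>_def)
    fix \<C> assume *: "\<C> \<noteq> {}" "subset.chain \<A> \<C>"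
    have "zm.subspace (\<Union>\<C>)" by (rule subspace_Union_chain[OF *]) (simp add: \<A>_def)
    moreover have "\<C> \<subseteq> \<A>" using *(2) unfolding subset.chain_def by blast
    ultimately show "\<Union>\<C> \<in> \<A>" using *(1) unfolding \<A>_def by blast
  qed
  then obtain E where "E \<in> \<A>" and max: "\<And>X. X \<in> \<A> \<Longrightarrow> E \<subseteq> X \<Longrightarrow> X = E" by blast
  then have E: "zm.subspace E" "E \<subseteq> D" "X \<subseteq> E"
    and ess: "\<And>x. x \<in> E \<Longrightarrow> x \<noteq> 0 \<Longrightarrow> \<exists>k. zmul k x \<in> X \<and> zmul k x \<noteq> 0"
    unfolding \<A>_def by auto
  have "divisible E"
  proof (rule divisible_of_primes)
    fix e p assume e: "e \<in> E" and p: "prime (p::nat)"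
    then have "int p \<noteq> 0" by auto
    then obtain y where y: "y \<in> D" "zmul (int p) y = e"
      using divisibleD[OF D(2,1), of e "int p"] e E(2) by blast
    show "\<exists>y\<in>E. zmul (int p) y = e"
    proof (cases "y \<in> E")
      case True then show ?thesis using y by blast
    next
      case False
      let ?X = "zm.span (insert y E)"
      have EX: "E \<subseteq> ?X" and yX: "y \<in> ?X" by (meson insert_subset order_trans subset_insertI zm.span_superset, simp add: zm.span_base)
      have "?X \<subseteq> D" using y E D(1) by (intro zm.span_minimal) auto
      moreover have "?X \<notin> \<A>" using max EX yX False by blast
      ultimately obtain z where z: "z \<in> ?X" "z \<noteq> 0" "\<And>k. zmul k z \<in> X \<Longrightarrow> zmul k z = 0"
        using EX E(3) unfolding \<A>_def by (auto simp del: zm.span_insert)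
      \<comment> \<open>A non-zero multiple of \<open>z\<close> in \<open>E\<close> would itself
        have a non-zero multiple in \<open>X\<close>.\<close>
      have zE: "zmul k z = 0" if kz: "zmul k z \<in> E" for k
      proof (rule ccontr)
        assume "zmul k z \<noteq> 0"
        then obtain j where "zmul j (zmul k z) \<in> X" "zmul j (zmul k z) \<noteq> 0" using ess kz by blast
        then show False using z(3)[of "j * k"] by simp
      qed
      obtain k where k: "z - zmul k y \<in> E" using z(1) mem_span_insert[OF E(1)] by blast
      let ?e = "z - zmul k y"
      have "zmul (int p) z = zmul (int p) ?e + zmul k (zmul (int p) y)"
        by (simp add: zm.scale_right_diff_distrib mult.commute)
      then have "zmul (int p) z \<in> E" using y(2) e k E(1) by (auto intro!: zm.subspace_add zm.subspace_scale)
      then have pz: "zmul (int p) z = 0" by (rule zE)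
      \<comment> \<open>If \<open>p\<close> divided \<open>k\<close>, then \<open>k y\<close> would
        be a multiple of \<open>e\<close>, and \<open>z\<close> would lie in
        \<open>E\<close>.\<close>
      have "\<not> int p dvd k"
      proof
        assume "int p dvd k"
        then obtain j where "k = j * int p" by (metis dvdE mult.commute)
        then have "z = ?e + zmul j e" using y(2) by auto
        then have "z \<in> E" using k e E(1) by (metis zm.subspace_add zm.subspace_scale)
        then show False using zE[of 1] z(2) by simp
      qed
      then have "coprime (int p) k" using p by (simp add: prime_imp_coprime)
      \<comment> \<open>Here \<open>y = u e + v (k y)\<close> with \<open>k y = z - ?e\<close>, so
        \<open>y - v z\<close> lies in \<open>E\<close>; because \<open>p z = 0\<close> it is still
        a \<open>p\<close>-th part of \<open>e\<close>.\<close>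
      then obtain u v where "u * int p + v * k = 1" using bezout_int[of "int p" k] by (metis coprime_iff_gcd_eq_1)
      then have "y = zmul (u * int p + v * k) y" by simp
      also have "\<dots> = zmul u e + zmul v (zmul k y)"
        by (simp add: zm.scale_left_distrib y(2)[symmetric])
      finally have "y - zmul v z = zmul u e - zmul v ?e"
        by (simp add: zm.scale_right_diff_distrib algebra_simps)
      then have "y - zmul v z \<in> E" using e k E(1) by (metis zm.subspace_diff zm.subspace_scale)
      moreover have "zmul (int p) (y - zmul v z) = e"
        using pz y(2) zm.scale_left_commute[of "int p" v z] by (simp add: zm.scale_right_diff_distrib)
      ultimately show ?thesis by blast
    qed
  qed
  moreover have "essential_in X E" using essential_in_iff[OF X(1) E(1)] E ess by blast
  ultimately show ?thesis using that E by blast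
qed

section \<open>The largest divisible subgroup\<close>

definition max_divisible :: "'a::ab_group_add set" where
  "max_divisible = \<Union>{B. zm.subspace B \<and> divisible B}"

lemma divisible_set_add:
  assumes "zm.subspace B" "divisible B" "zm.subspace C" "divisible C"
  shows "divisible (set_add B C)"
  unfolding divisible_iff[OF subspace_set_add[OF assms(1,3)]]
proof (intro ballI allI impI)
  fix x and n :: int assume "x \<in> set_add B C" and n: "n \<noteq> 0"
  then obtain b c where "b \<in> B" "c \<in> C" "x = b + c" by (elim set_addE)
  moreover from this obtain b' c' where "b' \<in> B" "zmul n b' = b" "c' \<in> C" "zmul n c' = c"
    using divisibleD assms n by meson
  ultimately show "\<exists>y\<in>set_add B C. zmul n y = x"
    by (intro bexI[of _ "b' + c'"]) (auto simp: zm.scale_right_distrib intro: set_addI)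
qed

text \<open>The union is closed under addition because the sum of two divisible subgroups is
  divisible.\<close>

lemma max_divisible: "zm.subspace (max_divisible :: 'a::ab_group_add set)" "divisible (max_divisible :: 'a set)"
proof -
  show "zm.subspace (max_divisible :: 'a set)"
  proof (rule zm.subspaceI)
    have "zm.subspace {0}" "divisible {0::'a}" by (auto simp: divisible_def nmul_eq_zmul)
    then show "0 \<in> (max_divisible :: 'a set)" unfolding max_divisible_def by blast
  next
    fix x y :: 'a assume "x \<in> max_divisible" "y \<in> max_divisible"
    then obtain B C where "zm.subspace B" "divisible B" "zm.subspace C" "divisible C" "x \<in> B" "y \<in> C"
      unfolding max_divisible_def by blast
    then show "x + y \<in> max_divisible" unfolding max_divisible_def
      using divisible_set_add subspace_set_add set_addI by blast
  next
    fix x :: 'a and k assume "x \<in> max_divisible"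
    then show "zmul k x \<in> max_divisible" unfolding max_divisible_def using zm.subspace_scale by blast
  qed
  show "divisible (max_divisible :: 'a set)"
    unfolding max_divisible_def divisible_def by blast
qed

section \<open>Divisibility of elements and types\<close>

text \<open>Heights, types and reducedness are all expressed through this relation, which turns
  arguments about suprema of exponents into Bezout computations.\<close>

definition divides_in :: "'a::ab_group_add set \<Rightarrow> int \<Rightarrow> 'a \<Rightarrow> bool" where
  "divides_in R m x \<longleftrightarrow> (\<exists>u\<in>R. zmul m u = x)"

lemma divides_in_zmul: "zm.subspace R \<Longrightarrow> divides_in R m x \<Longrightarrow> divides_in R m (zmul k x)"
  unfolding divides_in_def by (metis zm.scale_left_commute zm.subspace_scale)

lemma divides_in_add:
  "zm.subspace R \<Longrightarrow> divides_in R m x \<Longrightarrow> divides_in R m y \<Longrightarrow> divides_in R m (x + y)"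
  unfolding divides_in_def by (metis zm.scale_right_distrib zm.subspace_add)

lemma divides_in_dvd:
  assumes "zm.subspace R" "divides_in R m x" "k dvd m"
  shows "divides_in R k x"
proof -
  obtain j where "m = k * j" using assms(3) by blast
  then show ?thesis using assms(1,2) unfolding divides_in_def by (metis zm.scale_scale zm.subspace_scale)
qed

lemma divides_in_self_mult: "x \<in> R \<Longrightarrow> zm.subspace R \<Longrightarrow> divides_in R m (zmul m x)"
  unfolding divides_in_def by blast

lemma divides_in_cancel_coprime:
  assumes "zm.subspace R" "x \<in> R" "coprime a b" "divides_in R a (zmul b x)"
  shows "divides_in R a x"
proof -
  obtain u v where uv: "u * a + v * b = 1" using bezout_int[of a b] assms(3) by auto
  have "x = zmul (u * a + v * b) x" using uv by simp
  also have "\<dots> = zmul a (zmul u x) + zmul v (zmul b x)"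
    by (simp add: zm.scale_left_distrib mult.commute)
  finally show ?thesis
    using assms(1,2,4) by (metis divides_in_add divides_in_zmul divides_in_self_mult zm.subspace_scale)
qed

text \<open>With \<open>u a + v b = 1\<close> and \<open>a s = x = b t\<close>, the quotient of
  \<open>x\<close> by \<open>a b\<close> is \<open>u t + v s\<close>.\<close>

lemma divides_in_mult_coprime:
  assumes "zm.subspace R" "coprime a b" "divides_in R a x" "divides_in R b x"
  shows "divides_in R (a * b) x"
proof -
  obtain u v where uv: "u * a + v * b = 1" using bezout_int[of a b] assms(2) by auto
  obtain s t where st: "s \<in> R" "t \<in> R" "zmul a s = x" "zmul b t = x"
    using assms(3,4) unfolding divides_in_def by blast
  have "x = zmul (u * a + v * b) x" using uv by simp
  also have "\<dots> = zmul (u * a) (zmul b t) + zmul (v * b) (zmul a s)"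
    unfolding zm.scale_left_distrib by (simp only: st)
  also have "\<dots> = zmul (a * b) (zmul u t + zmul v s)"
    by (simp add: zm.scale_right_distrib algebra_simps)
  finally show ?thesis
    unfolding divides_in_def using assms(1) st
    by (metis zm.subspace_add zm.subspace_scale)
qed

lemma divides_in_cancel:
  assumes "torsion_free R" "zm.subspace R" "x \<in> R" "g \<noteq> 0" "divides_in R (g * m) (zmul g x)"
  shows "divides_in R m x"
proof -
  obtain u where u: "u \<in> R" "zmul g (zmul m u) = zmul g x" using assms(5) unfolding divides_in_def by auto
  then have "zmul m u = x" using torsion_free_cancel[OF assms(1,2) _ assms(3,4)] zm.subspace_scale[OF assms(2)] by blast
  then show ?thesis using u unfolding divides_in_def by blast
qed

lemma divides_in_div_gcd:
  assumes "torsion_free R" "zm.subspace R" "x \<in> R" "n \<noteq> 0" "divides_in R m (zmul n x)"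
  shows "divides_in R (m div gcd m n) x"
proof -
  define g where "g = gcd m n"
  obtain m' n' where mn: "m = g * m'" "n = g * n'" unfolding g_def by (meson gcd_dvd1 gcd_dvd2 dvdE)
  have g: "g \<noteq> 0" unfolding g_def using assms(4) by simp
  have "coprime m' n'" using g mn gcd_mult_distrib_int[of g m' n'] g_def
    by (metis assms(4) coprime_iff_gcd_eq_1 div_gcd_coprime nonzero_mult_div_cancel_left)
  moreover have "divides_in R m' (zmul n' x)"
    using divides_in_cancel[OF assms(1,2) _ g, of "zmul n' x" m'] assms(5) mn zm.subspace_scale[OF assms(2,3)] by simp
  ultimately have "divides_in R m' x" using divides_in_cancel_coprime assms by blast
  then show ?thesis using g mn unfolding g_def[symmetric] by simp
qed

text \<open>If \<open>p ^ j\<close> divides \<open>n\<close>, then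
  \<open>j < p ^ j \<le> \<bar>n\<bar>\<close>. So cancelling \<open>n\<close> costs fewer than
  \<open>\<bar>n\<bar>\<close> factors \<open>p\<close>, which the surplus in the exponent
  covers.\<close>

lemma divides_in_prime_power:
  assumes "torsion_free R" "zm.subspace R" "x \<in> R" "n \<noteq> 0" "prime (p::nat)"
    "divides_in R (int p ^ (k + nat \<bar>n\<bar>)) (zmul n x)"
  shows "divides_in R (int p ^ k) x"
proof -
  let ?m = "int p ^ (k + nat \<bar>n\<bar>)"
  have "gcd ?m n dvd ?m" by simp
  then obtain j where j: "gcd ?m n = int p ^ j" "j \<le> k + nat \<bar>n\<bar>"
    using divides_primepow_weak[of "int p" "gcd ?m n" "k + nat \<bar>n\<bar>"] assms(5) by auto
  have "int p ^ j dvd n" using j(1) by (metis gcd_dvd2)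
  then have "int p ^ j \<le> \<bar>n\<bar>" using assms(4) zdvd_imp_le[of "int p ^ j" "\<bar>n\<bar>"] by simp
  moreover have "int j < int p ^ j" 
    using power_gt_expt[of p j] prime_gt_1_nat[OF assms(5)] by (simp flip: of_nat_power)
  ultimately have "j \<le> nat \<bar>n\<bar>" by linarith
  then have "?m div gcd ?m n = int p ^ (k + nat \<bar>n\<bar> - j)"
    unfolding j(1) using assms(5) j(2) by (metis not_prime_0 of_nat_eq_0_iff power_diff)
  then have "divides_in R (int p ^ (k + nat \<bar>n\<bar> - j)) x" using divides_in_div_gcd[OF assms(1-4,6)] by simp
  moreover have "int p ^ k dvd int p ^ (k + nat \<bar>n\<bar> - j)" using \<open>j \<le> nat \<bar>n\<bar>\<close> by (intro le_imp_power_dvd) auto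
  ultimately show ?thesis using divides_in_dvd assms(2) by blast
qed

text \<open>A full prime power is split off \<open>m\<close>; the two coprime parts are treated
  separately and recombined.\<close>

lemma divides_in_of_prime_powers:
  assumes "zm.subspace R" "y \<in> R"
    and "\<And>p k. prime (p::nat) \<Longrightarrow> divides_in R (int p ^ k) x \<Longrightarrow> divides_in R (int p ^ k) y"
    and "m > 0" "divides_in R (int m) x"
  shows "divides_in R (int m) y"
  using assms(4,5)
proof (induction m rule: less_induct)
  case (less m)
  show ?case
  proof (cases "m = 1")
    case True
    then show ?thesis using assms(2) unfolding divides_in_def by auto
  next
    case False
    then obtain p where p: "prime p" "p dvd m" using prime_factor_nat by blast
    obtain k m' where km: "m = p ^ k * m'" "\<not> p dvd m'"
      using multiplicity_decompose'[of m p] less.prems p(1) by (metis not_gr_zero not_prime_unit)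
    then have "k > 0" using p(2) by (metis gr0I mult_1 power_0)
    then have "p ^ k > 1" using p(1) by (simp only: prime_gt_1_nat one_less_power)
    moreover have "m' > 0" using km less.prems by (metis gr0I mult_0_right)
    ultimately have m': "m' < m" "m' > 0" using km by auto
    have "divides_in R (int p ^ k) x" "divides_in R (int m') x"
      using less.prems(2) km assms(1) by (auto elim: divides_in_dvd)
    then have "divides_in R (int p ^ k) y" "divides_in R (int m') y"
      using assms(3) p(1) less.IH[OF m'] by blast+
    moreover have "coprime (int p ^ k) (int m')"
      using p(1) km(2) by (metis coprime_int_iff coprime_power_left_iff of_nat_power prime_imp_coprime)
    ultimately show ?thesis using divides_in_mult_coprime[OF assms(1)] km(1) by simp
  qed
qed

section \<open>Heights and types\<close>

lemma enat_le_iff: "h \<le> h' \<longleftrightarrow> (\<forall>k. enat k \<le> h \<longrightarrow> enat k \<le> h')" for h h' :: enat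
proof
  assume *: "\<forall>k. enat k \<le> h \<longrightarrow> enat k \<le> h'"
  show "h \<le> h'"
  proof (cases h')
    case (enat n)
    then have "\<not> enat (Suc n) \<le> h" using * by fastforce
    then show ?thesis using enat by (cases h) auto
  qed simp
qed auto

text \<open>The exponents \<open>k\<close> for which \<open>p ^ k\<close> divides \<open>x\<close>
  form an initial segment, so a failure at \<open>k\<close> bounds the supremum by
  \<open>k - 1\<close>.\<close>

lemma height_ge_iff:
  assumes "zm.subspace R" "x \<in> R"
  shows "enat k \<le> height R p x \<longleftrightarrow> divides_in R (int p ^ k) x"
proof
  assume "divides_in R (int p ^ k) x"
  then show "enat k \<le> height R p x"
    unfolding height_def divides_in_def nmul_eq_zmul by (intro SUP_upper) auto
next
  assume *: "enat k \<le> height R p x"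
  show "divides_in R (int p ^ k) x"
  proof (rule ccontr)
    assume neg: "\<not> divides_in R (int p ^ k) x"
    then have k: "k > 0" using assms(2) by (auto simp: divides_in_def intro!: gr0I)
    have "j < k" if "divides_in R (int p ^ j) x" for j
      using neg that divides_in_dvd[OF assms(1) that] by (meson le_imp_power_dvd not_le)
    then have "height R p x \<le> enat (k - 1)"
      unfolding height_def nmul_eq_zmul by (intro SUP_least) (force simp: divides_in_def)
    then have "enat k \<le> enat (k - 1)" using * by (rule order_trans[rotated])
    then show False using k by simp
  qed
qed

text \<open>Equivalent to the usual comparison of types by heights, but free of primes.\<close>

definition type_le :: "'a::ab_group_add set \<Rightarrow> 'a \<Rightarrow> 'a \<Rightarrow> bool" where
  "type_le R x y \<longleftrightarrow> (\<exists>N. N \<noteq> 0 \<and> (\<forall>m. divides_in R m x \<longrightarrow> divides_in R m (zmul N y)))"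

text \<open>Multiplication by \<open>N\<close> raises heights only at primes dividing
  \<open>N\<close>, and there by a finite amount. So the two heights can differ only at prime
  divisors of \<open>N * N'\<close>, and infinite heights agree everywhere.\<close>

lemma same_typeI:
  assumes R: "torsion_free R" "zm.subspace R" "x \<in> R" "y \<in> R" and "type_le R x y" "type_le R y x"
  shows "same_type R x y"
proof -
  have main: "\<exists>N\<noteq>0. \<forall>p. prime p \<longrightarrow> (height R p x = \<infinity> \<longrightarrow> height R p y = \<infinity>) \<and>
      (\<not> int p dvd N \<longrightarrow> height R p x \<le> height R p y)"
    if "x \<in> R" "y \<in> R" and le: "type_le R x y" for x y
  proof -
    obtain N where N: "N \<noteq> 0" "\<And>m. divides_in R m x \<Longrightarrow> divides_in R m (zmul N y)"
      using le unfolding type_le_def by blast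
    have "height R p y = \<infinity>" if "prime p" "height R p x = \<infinity>" for p
    proof -
      have "divides_in R (int p ^ (k + nat \<bar>N\<bar>)) x" for k
        using height_ge_iff[OF R(2) \<open>x \<in> R\<close>, of _ p] that(2) by (metis enat_ord_code(3))
      then have "enat k \<le> height R p y" for k
        using N divides_in_prime_power[OF R(1,2) \<open>y \<in> R\<close> N(1) that(1)] height_ge_iff[OF R(2) \<open>y \<in> R\<close>] by blast
      then have "\<infinity> \<le> height R p y" using enat_le_iff by blast
      then show ?thesis by simp
    qed
    moreover have "height R p x \<le> height R p y" if "prime p" "\<not> int p dvd N" for p
    proof -
      have "coprime (int p ^ k) N" for k using that by (simp add: prime_imp_coprime)
      then have "divides_in R (int p ^ k) x \<longrightarrow> divides_in R (int p ^ k) y" for k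
        using N(2) divides_in_cancel_coprime[OF R(2) \<open>y \<in> R\<close>] by blast
      then show ?thesis unfolding enat_le_iff[of "height R p x"]
        using height_ge_iff[OF R(2)] \<open>x \<in> R\<close> \<open>y \<in> R\<close> by metis
    qed
    ultimately show ?thesis using N(1) by blast
  qed
  obtain N where N: "N \<noteq> 0" "\<And>p. prime p \<Longrightarrow> (height R p x = \<infinity> \<longrightarrow> height R p y = \<infinity>) \<and>
      (\<not> int p dvd N \<longrightarrow> height R p x \<le> height R p y)" using main assms by meson
  obtain N' where N': "N' \<noteq> 0" "\<And>p. prime p \<Longrightarrow> (height R p y = \<infinity> \<longrightarrow> height R p x = \<infinity>) \<and>
      (\<not> int p dvd N' \<longrightarrow> height R p y \<le> height R p x)" using main assms by meson
  have "{p. prime p \<and> height R p x \<noteq> height R p y} \<subseteq> {p. p dvd nat \<bar>N * N'\<bar>}"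
  proof safe
    fix p assume "prime p" "height R p x \<noteq> height R p y"
    then have "int p dvd N \<or> int p dvd N'" using N(2) N'(2) by (metis order_antisym)
    then have "int p dvd \<bar>N * N'\<bar>" by auto
    then show "p dvd nat \<bar>N * N'\<bar>" by (metis int_dvd_int_iff int_nat_eq abs_ge_zero)
  qed
  moreover have "finite {p. p dvd nat \<bar>N * N'\<bar>}" using N(1) N'(1) by (intro finite_divisors_nat) simp
  ultimately show ?thesis unfolding same_type_def
    using N(2) N'(2) by (metis (no_types, lifting) finite_subset)
qed

section \<open>Groups whose pure subgroups are summands\<close>

text \<open>For torsion-free \<open>R\<close> the isolated subgroups are the pure ones, and the isolator is the pure hull.\<close>

definition isolated_in :: "'a::ab_group_add set \<Rightarrow> 'a set \<Rightarrow> bool" where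
  "isolated_in H R \<longleftrightarrow> zm.subspace H \<and> H \<subseteq> R \<and> (\<forall>x\<in>R. \<forall>n. n \<noteq> 0 \<longrightarrow> zmul n x \<in> H \<longrightarrow> x \<in> H)"

definition isolator :: "'a::ab_group_add set \<Rightarrow> 'a set \<Rightarrow> 'a set" where
  "isolator R H = {x\<in>R. \<exists>n. n \<noteq> 0 \<and> zmul n x \<in> H}"

definition splitting :: "'a::ab_group_add set \<Rightarrow> bool" where
  "splitting R \<longleftrightarrow> zm.subspace R \<and> (\<forall>H. isolated_in H R \<longrightarrow> (\<exists>K. int_dsum R H K))"

text \<open>In a torsion-free group the pure hull of an element divisible by all non-zero integers
  is divisible, so for such groups this says that there is no non-zero divisible subgroup.\<close>

definition reduced :: "'a::ab_group_add set \<Rightarrow> bool" where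
  "reduced R \<longleftrightarrow> (\<forall>x\<in>R. (\<forall>n. n \<noteq> 0 \<longrightarrow> divides_in R n x) \<longrightarrow> x = 0)"

lemma subspace_isolator:
  assumes "zm.subspace R" "zm.subspace H"
  shows "zm.subspace (isolator R H)"
proof (rule zm.subspaceI)
  show "0 \<in> isolator R H" using assms by (auto simp: isolator_def zm.subspace_0 intro!: exI[of _ 1])
next
  fix x y assume "x \<in> isolator R H" "y \<in> isolator R H"
  then obtain m n where *: "x \<in> R" "y \<in> R" "m \<noteq> 0" "n \<noteq> 0" "zmul m x \<in> H" "zmul n y \<in> H"
    unfolding isolator_def by blast
  have "zmul (m * n) (x + y) = zmul n (zmul m x) + zmul m (zmul n y)"
    by (simp add: zm.scale_right_distrib mult.commute)
  then have "zmul (m * n) (x + y) \<in> H" using * assms(2) by (metis zm.subspace_add zm.subspace_scale)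
  then show "x + y \<in> isolator R H" unfolding isolator_def
    using * zm.subspace_add[OF assms(1)] by (intro CollectI conjI exI[of _ "m * n"]) auto
next
  fix x k assume "x \<in> isolator R H"
  then obtain n where n: "x \<in> R" "n \<noteq> 0" "zmul n x \<in> H" unfolding isolator_def by blast
  have "zmul n (zmul k x) = zmul k (zmul n x)" by (rule zm.scale_left_commute)
  then have "zmul n (zmul k x) \<in> H" using zm.subspace_scale[OF assms(2) n(3)] by simp
  then show "zmul k x \<in> isolator R H" unfolding isolator_def
    using n zm.subspace_scale[OF assms(1)] by blast
qed

lemma isolator_superset: "H \<subseteq> R \<Longrightarrow> H \<subseteq> isolator R H"
  unfolding isolator_def by (auto intro!: exI[of _ 1])

lemma isolated_isolator:
  assumes "zm.subspace R" "zm.subspace H"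
  shows "isolated_in (isolator R H) R"
  unfolding isolated_in_def
proof (intro conjI ballI allI impI)
  show "zm.subspace (isolator R H)" by (rule subspace_isolator[OF assms])
  show "isolator R H \<subseteq> R" unfolding isolator_def by blast
  fix x n assume "x \<in> R" "n \<noteq> (0::int)" "zmul n x \<in> isolator R H"
  then obtain m where "m \<noteq> 0" "zmul (m * n) x \<in> H" unfolding isolator_def by auto
  then show "x \<in> isolator R H" using \<open>x \<in> R\<close> \<open>n \<noteq> 0\<close> unfolding isolator_def
    by (intro CollectI conjI exI[of _ "m * n"]) auto
qed

text \<open>An isolated subgroup of \<open>C\<close> is isolated in \<open>R\<close>, since the
  \<open>A\<close>-component of an element is zero as soon as some non-zero multiple of it is. The
  modular law cuts its complement in \<open>R\<close> down to \<open>C\<close>.\<close>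

lemma splitting_summand:
  assumes "splitting R" "torsion_free R" "int_dsum R A C"
  shows "splitting C"
  unfolding splitting_def
proof (intro conjI allI impI)
  note * = int_dsumD[OF assms(3)]
  show "zm.subspace C" by (rule *(3))
  fix H assume H: "isolated_in H C"
  have "isolated_in H R" unfolding isolated_in_def
  proof (intro conjI ballI allI impI)
    show "zm.subspace H" "H \<subseteq> R" using H *(5) by (auto simp: isolated_in_def)
    fix x n assume x: "x \<in> R" "n \<noteq> (0::int)" "zmul n x \<in> H"
    obtain a c where ac: "a \<in> A" "c \<in> C" "x = a + c" using *(7) x(1) by blast
    have "zmul n a + zmul n c = 0 + zmul n x" using ac by (simp add: zm.scale_right_distrib)
    then have "zmul n a = 0"
      using ac x H * int_dsum_unique(1)[OF assms(3), of "zmul n a" 0 "zmul n c" "zmul n x"]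
      by (auto simp: isolated_in_def zm.subspace_scale zm.subspace_0)
    then have "a = 0" using torsion_freeD[OF assms(2)] ac(1) *(4) x(2) by blast
    then show "x \<in> H" using H x ac by (auto simp: isolated_in_def)
  qed
  then obtain K where "int_dsum R H K" using assms(1) unfolding splitting_def by blast
  then have "int_dsum C H (C \<inter> K)" using int_dsum_modular *(3,5) H unfolding isolated_in_def by blast
  then show "\<exists>K. int_dsum C H K" by blast
qed

section \<open>The torsion subgroup and the decomposition of the group\<close>

lemma subspace_torsion: "zm.subspace (torsion_part (UNIV :: 'a::ab_group_add set))"
proof -
  have "torsion_part (UNIV :: 'a set) = isolator UNIV {0}"
    by (auto simp: torsion_part_def isolator_def has_finite_order_iff)
  then show ?thesis using subspace_isolator[of UNIV "{0::'a}"] by simp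
qed

text \<open>If \<open>t\<close> is torsion and \<open>s\<close> has infinite order, a complement of a torsion-free summand containing
  \<open>n s + t\<close> contains an element \<open>b\<close> with \<open>n b = - t\<close>.\<close>

lemma divisible_torsion:
  assumes ext: "\<And>H::'a::ab_group_add set. zm.subspace H \<Longrightarrow> \<exists>S. direct_summand S \<and> essential_in H S"
    and s: "\<not> has_finite_order (s::'a)"
  shows "divisible (torsion_part (UNIV::'a set))"
  unfolding divisible_iff[OF subspace_torsion]
proof (intro ballI allI impI)
  fix t :: 'a and n :: int assume t: "t \<in> torsion_part UNIV" and n: "n \<noteq> 0"
  obtain q where q: "q \<noteq> 0" "zmul q t = 0" using t unfolding torsion_part_def has_finite_order_iff by blast
  define h where "h = zmul n s + t"
  \<comment> \<open>\<open>h\<close> has infinite order: multiplying \<open>k h = 0\<close> by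
    \<open>q\<close> removes \<open>t\<close> and leaves a multiple of \<open>s\<close>.\<close>
  have h: "k = 0" if "zmul k h = 0" for k
  proof -
    have "zmul (q * k * n) s = zmul q (zmul k h) - zmul k (zmul q t)"
      unfolding h_def by (simp add: zm.scale_right_distrib algebra_simps)
    then have "zmul (q * k * n) s = 0" using that q by simp
    then have "q * k * n = 0" using s unfolding has_finite_order_iff by blast
    then show ?thesis using q n by simp
  qed
  have H: "zm.subspace (zm.span {h})" by simp
  obtain S where "direct_summand S" and ess: "essential_in (zm.span {h}) S" using ext[OF H] by blast
  then obtain K where SK: "int_dsum UNIV S K" unfolding direct_summand_def by blast
  note * = int_dsumD[OF SK]
  \<comment> \<open>\<open>S\<close> is torsion-free because an infinite cyclic group is essential
    in it.\<close>
  have tf: "x = 0" if x: "x \<in> S" "m \<noteq> 0" "zmul m x = 0" for x m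
  proof (rule ccontr)
    assume "x \<noteq> 0"
    then obtain k where k: "zmul k x \<in> zm.span {h}" "zmul k x \<noteq> 0" using essential_inD[OF ess H *(2) x(1)] by metis
    then obtain j where j: "zmul k x = zmul j h" unfolding zm.span_singleton by blast
    have "zmul (m * j) h = zmul k (zmul m x)" using j by (metis zm.scale_scale mult.commute)
    then have "m * j = 0" using h[of "m * j"] x(3) by simp
    then show False using x(2) j k(2) by simp
  qed
  have hS: "h \<in> S" using ess zm.span_base[of h "{h}"] unfolding essential_in_def by blast
  obtain a b where ab: "a \<in> S" "b \<in> K" "s = a + b" using *(7)[of s] by auto
  obtain a' b' where ab': "a' \<in> S" "b' \<in> K" "t = a' + b'" using *(7)[of t] by auto
  have "zmul q a' + zmul q b' = 0" using q(2) ab' by (simp add: zm.scale_right_distrib)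
  then have "zmul q a' = 0" using int_dsum_zero[OF SK] ab' *(2,3) zm.subspace_scale by metis
  then have "a' = 0" using tf ab'(1) q(1) by blast
  \<comment> \<open>The relation \<open>n s + t - h = 0\<close> is split along \<open>S\<close> and
    \<open>K\<close>; the component of \<open>t\<close> in the torsion-free \<open>S\<close>
    vanishes, so all of \<open>t\<close> goes to \<open>K\<close>.\<close>
  have "(zmul n a - h) + (zmul n b + t) = 0"
    unfolding h_def ab(3) by (simp add: zm.scale_right_distrib algebra_simps)
  moreover have "zmul n a - h \<in> S" using ab hS *(2) by (auto intro: zm.subspace_diff zm.subspace_scale)
  moreover have "zmul n b + t \<in> K" using ab ab' \<open>a' = 0\<close> *(3) by (auto intro: zm.subspace_add zm.subspace_scale)
  ultimately have "zmul n b + t = 0" using int_dsum_zero[OF SK] by blast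
  then have nb: "zmul n (- b) = t" by (metis add.inverse_inverse add_eq_0_iff zm.scale_minus_right)
  then have "zmul (q * n) (- b) = 0" using q(2) by (metis zm.scale_scale)
  then have "- b \<in> torsion_part UNIV" unfolding torsion_part_def has_finite_order_iff
    using q(1) n by (intro CollectI conjI exI[of _ "q * n"]) auto
  then show "\<exists>y\<in>torsion_part UNIV. zmul n y = t" using nb by blast
qed

text \<open>\<open>D\<close> is the largest divisible subgroup; it contains the torsion, so a
  complement \<open>R\<close> is torsion-free. An element of \<open>R\<close> divisible by all
  integers has a divisible pure hull, which lies in \<open>D \<inter> R\<close>. For
  \<open>H\<close> pure in \<open>R\<close>, the group \<open>D + H\<close> equals every summand in
  which it is essential, and a complement of it yields one of \<open>H\<close> in
  \<open>R\<close>.\<close>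

lemma extending_decomposition:
  assumes ext: "\<And>H::'a::ab_group_add set. zm.subspace H \<Longrightarrow> \<exists>S. direct_summand S \<and> essential_in H S"
    and T: "divisible (torsion_part (UNIV::'a set))"
  obtains D D0 R :: "'a::ab_group_add set" where "int_dsum UNIV D R" "divisible D" "int_dsum D (torsion_part D) D0" "torsion_free D0"
    "torsion_free R" "reduced R" "splitting R"
proof -
  let ?T = "torsion_part (UNIV::'a set)" and ?D = "max_divisible :: 'a set"
  note T' = subspace_torsion[where 'a='a]
  have TD: "?T \<subseteq> ?D" using T T' unfolding max_divisible_def by blast
  then have TDeq: "torsion_part ?D = ?T" unfolding torsion_part_def by blast
  have sub0: "zm.subspace {0::'a}" by simp
  obtain R where DR: "int_dsum UNIV ?D R"
    using divisible_complement[OF max_divisible sub0] by blast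
  obtain M where "int_dsum UNIV ?T M" using divisible_complement[OF T' T sub0] by blast
  then have D0: "int_dsum ?D (torsion_part ?D) (?D \<inter> M)"
    unfolding TDeq using int_dsum_modular max_divisible(1) TD by blast
  have tf: "torsion_free U" if "int_dsum A ?T U" for A U
    using int_dsumD(6)[OF that] unfolding torsion_free_def torsion_part_def by blast
  note * = int_dsumD[OF DR]
  have tfR: "torsion_free R"
    using *(6) TD unfolding torsion_free_def torsion_part_def by blast
  have "reduced R" unfolding reduced_def
  proof (intro ballI impI)
    fix x assume x: "x \<in> R" and dv: "\<forall>n. n \<noteq> 0 \<longrightarrow> divides_in R n x"
    let ?B = "isolator R (zm.span {x})"
    have B: "zm.subspace ?B" by (rule subspace_isolator[OF *(3) zm.subspace_span])
    have "divisible ?B" unfolding divisible_iff[OF B]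
    proof (intro ballI allI impI)
      fix z and n :: int assume "z \<in> ?B" and n: "n \<noteq> 0"
      then obtain k l where z: "z \<in> R" "k \<noteq> 0" "zmul k z = zmul l x"
        unfolding isolator_def zm.span_singleton by blast
      \<comment> \<open>After dividing \<open>x\<close> by \<open>k n\<close> and cancelling
        \<open>k\<close>, the element \<open>l u\<close> is an \<open>n\<close>-th part of
        \<open>z\<close>.\<close>
      obtain u where u: "u \<in> R" "zmul (k * n) u = x" using dv z(2) n unfolding divides_in_def by (metis mult_eq_0_iff)
      have lu: "zmul l u \<in> R" using u(1) *(3) zm.subspace_scale by blast
      have eq: "zmul (k * n) (zmul l u) = zmul l x" using u(2) by (metis zm.scale_left_commute)
      then have "zmul k (zmul n (zmul l u)) = zmul k z" using z(3) by (simp add: mult.assoc)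
      then have "zmul n (zmul l u) = z"
        using torsion_free_cancel[OF tfR *(3) zm.subspace_scale[OF *(3) lu] z(1,2)] by simp
      moreover have "zmul l u \<in> ?B" unfolding isolator_def zm.span_singleton using lu eq z(2) n
        by (intro CollectI conjI exI[of _ "k * n"]) auto
      ultimately show "\<exists>y\<in>?B. zmul n y = z" by blast
    qed
    then have "?B \<subseteq> ?D" using B unfolding max_divisible_def by blast
    moreover have "x \<in> ?B" using isolator_superset[of "zm.span {x}" R] zm.span_base[of x "{x}"]
        zm.span_minimal[of "{x}" R] *(3) x by blast
    ultimately show "x = 0" using *(6) x by blast
  qed
  moreover have "splitting R" unfolding splitting_def
  proof (intro conjI allI impI)
    show "zm.subspace R" by (rule *(3))
    fix H assume H: "isolated_in H R"
    then have H': "zm.subspace H" "H \<subseteq> R" unfolding isolated_in_def by auto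
    let ?Q = "set_add ?D H"
    have Q: "zm.subspace ?Q" using subspace_set_add max_divisible(1) H'(1) by blast
    \<comment> \<open>\<open>?Q\<close> is isolated in the whole group, so it has no proper
      essential extension there.\<close>
    have iso: "x \<in> ?Q" if n: "n \<noteq> 0" and nx: "zmul n x \<in> ?Q" for x n
    proof -
      obtain d r where dr: "d \<in> ?D" "r \<in> R" "x = d + r" using *(7)[of x] by auto
      obtain d' h where d'h: "d' \<in> ?D" "h \<in> H" "zmul n x = d' + h" using nx by (elim set_addE)
      have "zmul n d + zmul n r = d' + h" using dr d'h by (simp add: zm.scale_right_distrib)
      then have "zmul n r = h" using int_dsum_unique(2)[OF DR] dr d'h H'(2) *(2,3) zm.subspace_scale by blast
      then have "r \<in> H" using H d'h dr n unfolding isolated_in_def by blast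
      then show ?thesis using dr set_addI by blast
    qed
    obtain S where S: "direct_summand S" "essential_in ?Q S" using ext[OF Q] by blast
    then obtain K where SK: "int_dsum UNIV S K" unfolding direct_summand_def by blast
    have "S \<subseteq> ?Q"
    proof
      fix x assume "x \<in> S"
      then obtain k where "k \<noteq> 0" "zmul k x \<in> ?Q" using essential_inD[OF S(2) Q int_dsumD(2)[OF SK]] by blast
      then show "x \<in> ?Q" by (rule iso)
    qed
    then have "S = ?Q" using S(2) unfolding essential_in_def by blast
    then have QK: "int_dsum UNIV ?Q K" using SK by simp
    note q = int_dsumD[OF QK]
    have DQ: "?D \<subseteq> ?Q" "H \<subseteq> ?Q" using subset_set_add[OF max_divisible(1) H'(1)] by auto
    \<comment> \<open>For \<open>x\<close> in \<open>R\<close> with \<open>x = d + h + k\<close>,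
      the part \<open>d + k = x - h\<close> is again in \<open>R\<close>; this dictates the
      complement.\<close>
    have "int_dsum R H (set_add ?D K \<inter> R)" unfolding int_dsum_iff
    proof (intro conjI ballI)
      show "H \<inter> (set_add ?D K \<inter> R) \<subseteq> {0}"
      proof
        fix x assume x: "x \<in> H \<inter> (set_add ?D K \<inter> R)"
        then obtain d k where dk: "d \<in> ?D" "k \<in> K" "x = d + k" by (auto elim: set_addE)
        then have "k = x - d" by simp
        then have "k \<in> ?Q" using x dk(1) DQ Q zm.subspace_diff by blast
        then have "k = 0" using q(6) dk(2) by blast
        then show "x \<in> {0}" using *(6) x dk by auto
      qed
      fix x assume x: "x \<in> R"
      obtain y k where yk: "y \<in> ?Q" "k \<in> K" "x = y + k" using q(7)[of x] by auto
      then obtain d h where dh: "d \<in> ?D" "h \<in> H" "y = d + h" by (auto elim: set_addE)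
      have "d + k = x - h" using yk dh by simp
      then have "d + k \<in> R" using x dh(2) H'(2) *(3) zm.subspace_diff by (metis subsetD)
      moreover have "d + k \<in> set_add ?D K" using dh yk by (intro set_addI)
      ultimately show "\<exists>b\<in>H. \<exists>c\<in>set_add ?D K \<inter> R. x = b + c"
        using yk dh by (intro bexI[of _ h] bexI[of _ "d + k"]) (auto simp: algebra_simps)
    qed (use H' *(2,3) q(3) zm.subspace_inter[OF subspace_set_add[OF *(2) q(3)] *(3)] in auto)
    then show "\<exists>K. int_dsum R H K" by blast
  qed
  ultimately show ?thesis using that[OF DR max_divisible(2) D0 tf[OF D0[unfolded TDeq]] tfR] by simp
qed

section \<open>Homogeneity\<close>

text \<open>Some projection \<open>?pi\<close> onto the pure hull of \<open>n x + y\<close> does not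
  kill \<open>y\<close>, so \<open>k ?pi(y) = l (n x + y)\<close> with \<open>k\<close> and
  \<open>l\<close> non-zero. A divisor of \<open>y\<close> divides \<open>?pi(y)\<close>, hence
  divides \<open>l (n x + y)\<close> and its \<open>A\<close>-component
  \<open>l n x\<close>.\<close>

lemma splitting_type_le:
  assumes spl: "splitting R" "torsion_free R" "reduced R" and AC: "int_dsum R A C"
    and x: "x \<in> A" and y: "y \<in> C" "y \<noteq> 0"
  shows "type_le R y x"
proof -
  note * = int_dsumD[OF AC]
  have xy: "x \<in> R" "y \<in> R" using x y *(4,5) by auto
  define L where "L n = isolator R (zm.span {zmul n x + y})" for n
  have L: "isolated_in (L n) R" "zmul n x + y \<in> L n" for n
  proof -
    show "isolated_in (L n) R" unfolding L_def by (rule isolated_isolator[OF *(1) zm.subspace_span])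
    have "zmul n x + y \<in> R" using xy *(1) by (auto intro: zm.subspace_add zm.subspace_scale)
    then have "zm.span {zmul n x + y} \<subseteq> R" using *(1) by (intro zm.span_minimal) auto
    then show "zmul n x + y \<in> L n" unfolding L_def
      using isolator_superset zm.span_base[of "zmul n x + y" "{zmul n x + y}"] by blast
  qed
  then have "\<exists>K. int_dsum R (L n) K" for n using spl(1) unfolding splitting_def by blast
  then obtain K where LK: "int_dsum R (L n) (K n)" for n by metis
  have "\<exists>n. n \<noteq> 0 \<and> dproj (L n) (K n) y \<noteq> 0"
  proof (rule ccontr)
    assume "\<nexists>n. n \<noteq> 0 \<and> dproj (L n) (K n) y \<noteq> 0"
    then have p0: "dproj (L n) (K n) y = 0" if "n \<noteq> 0" for n using that by blast
    \<comment> \<open>The projection fixes \<open>n x + y\<close> and kills \<open>y\<close>, so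
      \<open>n x + y = n ?x'\<close> and \<open>y = n (?x' - x)\<close>.\<close>
    have "divides_in R n y" if n: "n \<noteq> 0" for n
    proof -
      let ?x' = "dproj (L n) (K n) x"
      have "zmul n x + y = dproj (L n) (K n) (zmul n x + y)" using dproj_id[OF LK L(2)] by simp
      also have "\<dots> = zmul n ?x'"
        using dproj_add[OF LK] dproj_zmul[OF LK] xy p0[OF n] *(1) by (simp add: zm.subspace_scale)
      finally have "zmul n (?x' - x) = y" by (simp add: zm.scale_right_diff_distrib algebra_simps)
      moreover have "?x' - x \<in> R"
        using dproj_in(1)[OF LK xy(1), of n] int_dsumD(4)[OF LK, of n] xy(1) *(1) by (auto intro: zm.subspace_diff)
      ultimately show ?thesis unfolding divides_in_def by blast
    qed
    then show False using spl(3) xy(2) y(2) unfolding reduced_def by blast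
  qed
  then obtain n where n: "n \<noteq> 0" "dproj (L n) (K n) y \<noteq> 0" by blast
  let ?pi = "dproj (L n) (K n)"
  have piL: "?pi u \<in> L n" "?pi u \<in> R" if "u \<in> R" for u
    using dproj_in(1)[OF LK that] int_dsumD(4)[OF LK, of n] by auto
  obtain k l where kl: "k \<noteq> 0" "zmul k (?pi y) = zmul l (zmul n x + y)"
    using piL(1)[OF xy(2)] unfolding L_def isolator_def zm.span_singleton by auto
  have "l \<noteq> 0"
  proof
    assume "l = 0"
    then have "zmul k (?pi y) = 0" using kl by simp
    then show False using torsion_freeD[OF spl(2) piL(2)[OF xy(2)]] kl(1) n(2) by blast
  qed
  have "divides_in R m (zmul (l * n) x)" if m: "divides_in R m y" for m
  proof -
    obtain u where u: "u \<in> R" "zmul m u = y" using m unfolding divides_in_def by blast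
    have "zmul m (?pi u) = ?pi y" using dproj_zmul[OF LK u(1)] u(2) by metis
    then have "zmul m (zmul k (?pi u)) = zmul l (zmul n x + y)" using kl(2) by (metis zm.scale_left_commute)
    moreover define w where "w = zmul k (?pi u)"
    moreover have w: "w \<in> R" unfolding w_def using piL(2)[OF u(1)] *(1) zm.subspace_scale by blast
    ultimately have "zmul m (dproj A C w) = dproj A C (zmul l (zmul n x + y))"
      using dproj_zmul[OF AC] by metis
    also have "\<dots> = zmul l (zmul n x)"
      using dproj_zmul[OF AC] dproj_add[OF AC] dproj_id[OF AC x] dproj_0[OF AC y(1)] xy *(1)
      by (simp add: zm.subspace_add zm.subspace_scale)
    finally have "zmul m (dproj A C w) = zmul (l * n) x" by simp
    moreover have "dproj A C w \<in> R" using dproj_in(1)[OF AC w] *(4) by blast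
    ultimately show ?thesis unfolding divides_in_def by blast
  qed
  then show ?thesis unfolding type_le_def using \<open>l \<noteq> 0\<close> n(1) by (intro exI[of _ "l * n"]) auto
qed

text \<open>With respect to the pure hull of \<open>x\<close>, write \<open>z = a + c\<close>. The
  component \<open>a\<close> has a non-zero multiple that is a multiple of \<open>x\<close>, and
  \<open>splitting_type_le\<close> bounds \<open>c\<close>, so the type of \<open>x\<close> is at
  most that of \<open>z\<close>. Conversely a divisor of \<open>z\<close> divides \<open>a\<close>
  and \<open>c\<close>; if \<open>a = 0\<close>, then \<open>z\<close> lies in the complement and
  the lemma applies in the other direction.\<close>

lemma splitting_homogeneous:
  assumes spl: "splitting R" "torsion_free R" "reduced R"
  shows "homogeneous R"
  unfolding homogeneous_def
proof (intro conjI ballI impI)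
  show "torsion_free R" by (rule spl(2))
  fix x z assume x: "x \<in> R" and z: "z \<in> R" and "x \<noteq> 0 \<and> z \<noteq> 0"
  then have nz: "x \<noteq> 0" "z \<noteq> 0" by auto
  have R: "zm.subspace R" using spl(1) unfolding splitting_def by blast
  let ?A = "isolator R (zm.span {x})"
  have "isolated_in ?A R" by (rule isolated_isolator[OF R zm.subspace_span])
  then obtain C where AC: "int_dsum R ?A C" using spl(1) unfolding splitting_def by blast
  note * = int_dsumD[OF AC]
  have xA: "x \<in> ?A" using isolator_superset[of "zm.span {x}" R] zm.span_base[of x "{x}"]
        zm.span_minimal[of "{x}" R] R x by blast
  obtain a c where ac: "a \<in> ?A" "c \<in> C" "z = a + c" using *(7)[OF z] by blast
  have acR: "a \<in> R" "c \<in> R" using ac *(4,5) by auto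
  obtain j k where jk: "j \<noteq> 0" "zmul j a = zmul k x" using ac(1) unfolding isolator_def zm.span_singleton by auto
  have "\<exists>N. N \<noteq> 0 \<and> (\<forall>m. divides_in R m x \<longrightarrow> divides_in R m (zmul N c))"
  proof (cases "c = 0")
    case True
    then show ?thesis using R by (intro exI[of _ 1]) (auto simp: divides_in_def zm.subspace_0 intro!: bexI[of _ 0])
  next
    case False
    then show ?thesis
      using splitting_type_le[OF spl int_dsum_commute[OF AC] ac(2) xA nz(1)] unfolding type_le_def by blast
  qed
  then obtain N where N: "N \<noteq> 0" "\<And>m. divides_in R m x \<Longrightarrow> divides_in R m (zmul N c)" by blast
  have "divides_in R m (zmul (N * j) z)" if m: "divides_in R m x" for m
  proof -
    have "divides_in R m (zmul (N * k) x)" "divides_in R m (zmul j (zmul N c))"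
      using divides_in_zmul[OF R] m N by blast+
    then have "divides_in R m (zmul (N * k) x + zmul j (zmul N c))" by (rule divides_in_add[OF R])
    moreover have "zmul (N * k) x + zmul j (zmul N c) = zmul (N * j) z"
      unfolding ac(3) zm.scale_right_distrib by (metis jk(2) mult.commute zm.scale_scale)
    ultimately show ?thesis by simp
  qed
  then have 1: "type_le R x z" unfolding type_le_def using N(1) jk(1) by (intro exI[of _ "N * j"]) auto
  have dv: "divides_in R m a \<and> divides_in R m c" if m: "divides_in R m z" for m
  proof -
    obtain u where u: "u \<in> R" "zmul m u = z" using m unfolding divides_in_def by blast
    obtain a' c' where ac': "a' \<in> ?A" "c' \<in> C" "u = a' + c'" using *(7)[OF u(1)] by blast
    have "zmul m a' + zmul m c' = a + c" using u ac ac' by (simp add: zm.scale_right_distrib)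
    then have "zmul m a' = a" "zmul m c' = c"
      using int_dsum_unique[OF AC zm.subspace_scale[OF *(2) ac'(1)] ac(1) zm.subspace_scale[OF *(3) ac'(2)] ac(2)] by auto
    then show ?thesis using ac' *(4,5) unfolding divides_in_def by blast
  qed
  have 2: "type_le R z x"
  proof (cases "a = 0")
    case True
    then have "c = z" using ac by simp
    then show ?thesis using splitting_type_le[OF spl AC xA ac(2)] nz(2) by simp
  next
    case False
    then have "k \<noteq> 0" using jk torsion_freeD[OF spl(2) acR(1)] by force
    moreover have "divides_in R m (zmul k x)" if "divides_in R m z" for m
      using dv[OF that] divides_in_zmul[OF R] jk(2) by metis
    ultimately show ?thesis unfolding type_le_def by blast
  qed
  show "same_type R x z" by (rule same_typeI[OF spl(2) R x z 1 2])
qed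

section \<open>Rank-one summands and finite rank\<close>

text \<open>Any two elements have non-zero multiples in the cyclic group of \<open>x\<close>, and
  cross-multiplication gives a dependence between them.\<close>

lemma rank_one_isolator:
  assumes "torsion_free R" "zm.subspace R" "x \<in> R" "x \<noteq> 0"
  shows "rank_one (isolator R (zm.span {x}))"
proof -
  let ?A = "isolator R (zm.span {x})"
  have A: "zm.subspace ?A" by (rule subspace_isolator[OF assms(2) zm.subspace_span])
  have AR: "?A \<subseteq> R" unfolding isolator_def by blast
  have xA: "x \<in> ?A" unfolding isolator_def using assms(3) zm.span_base[of x "{x}"]
    by (intro CollectI conjI exI[of _ 1]) auto
  have "card X \<le> 1" if X: "X \<subseteq> ?A" "z_independent X" for X
  proof (rule ccontr)
    assume "\<not> card X \<le> 1"
    then obtain a b where ab: "a \<in> X" "b \<in> X" "a \<noteq> b"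
      by (metis One_nat_def card_le_Suc0_iff_eq X(2) z_independent_def)
    have fin: "finite X" and ind: "\<And>c. (\<Sum>x\<in>X. zmul (c x) x) = 0 \<Longrightarrow> \<forall>x\<in>X. c x = 0"
      using X(2) unfolding z_independent_def by auto
    have dep: "k = 0 \<and> l = 0" if eq: "zmul k a = zmul l b" for k l
    proof -
      \<comment> \<open>Writing the coefficients as a difference of two functions, each supported at
        one point, lets the sum over \<open>X\<close> collapse to two terms.\<close>
      let ?c = "\<lambda>z. (if z = a then k else 0) - (if z = b then l else 0)"
      have "zmul (?c z) z = (if z = a then zmul k a else 0) - (if z = b then zmul l b else 0)" for z
        by (simp add: zm.scale_left_diff_distrib)
      then have "(\<Sum>x\<in>X. zmul (?c x) x) = zmul k a - zmul l b"
        using fin ab by (simp add: sum_subtractf)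
      then have "\<forall>x\<in>X. ?c x = 0" using ind[of ?c] eq by simp
      then have "?c a = 0" "?c b = 0" using ab by blast+
      then show ?thesis using ab(3) by simp
    qed
    obtain k l where a: "k \<noteq> 0" "zmul k a = zmul l x"
      using ab(1) X(1) unfolding isolator_def zm.span_singleton by blast
    obtain k' l' where b: "k' \<noteq> 0" "zmul k' b = zmul l' x"
      using ab(2) X(1) unfolding isolator_def zm.span_singleton by blast
    have "zmul (l' * k) a = zmul (l * k') b" using a b by (metis zm.scale_scale mult.commute)
    then have "l' = 0" using dep a(1) by fastforce
    then have "zmul 0 a = zmul k' b" using b by simp
    then show False using dep b(1) by blast
  qed
  then show ?thesis unfolding rank_one_def is_subgroup_iff
    using A AR xA assms(1,4) unfolding torsion_free_def by blast
qed

text \<open>An elimination step. If \<open>x0\<close> in \<open>X\<close> has a non-zero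
  \<open>A\<close>-component, suitable combinations with \<open>x0\<close> cancel the
  \<open>A\<close>-components of the other members. These combinations are independent in
  \<open>C'\<close>, so \<open>X\<close> exceeds the bound for \<open>C'\<close> by at most
  one.\<close>

lemma finite_rank_extend:
  assumes AC: "int_dsum C A C'" and fr: "finite_rank C'"
    and rk: "\<And>a b. a \<in> A \<Longrightarrow> b \<in> A \<Longrightarrow> a \<noteq> 0 \<Longrightarrow> \<exists>k l. k \<noteq> 0 \<and> zmul k b = zmul l a"
  shows "finite_rank C"
proof -
  note * = int_dsumD[OF AC]
  obtain n where n: "\<And>X. X \<subseteq> C' \<Longrightarrow> z_independent X \<Longrightarrow> card X \<le> n" using fr unfolding finite_rank_def by blast
  have "card X \<le> Suc n" if X: "X \<subseteq> C" "z_independent X" for X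
  proof (cases "\<forall>x\<in>X. dproj A C' x = 0")
    case True
    have "X \<subseteq> C'"
    proof
      fix x assume "x \<in> X"
      then show "x \<in> C'" using dproj_in(2)[OF AC, of x] True X(1) by auto
    qed
    then show ?thesis using n X(2) by (simp add: le_SucI)
  next
    case False
    then obtain x0 where x0: "x0 \<in> X" "dproj A C' x0 \<noteq> 0" by blast
    let ?a = "dproj A C' x0"
    have "\<exists>k l. k \<noteq> 0 \<and> zmul k (dproj A C' x) = zmul l ?a" if "x \<in> X" for x
      using rk[OF _ _ x0(2)] dproj_in(1)[OF AC] x0(1) that X(1) by blast
    then obtain k l where kl: "\<And>x. x \<in> X \<Longrightarrow> k x \<noteq> 0" "\<And>x. x \<in> X \<Longrightarrow> zmul (k x) (dproj A C' x) = zmul (l x) ?a"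
      by metis
    define y where "y x = zmul (k x) x - zmul (l x) x0" for x
    have fin: "finite X" and ind: "\<And>c. (\<Sum>x\<in>X. zmul (c x) x) = 0 \<Longrightarrow> \<forall>x\<in>X. c x = 0"
      using X(2) unfolding z_independent_def by auto
    have yC: "y x \<in> C'" if x: "x \<in> X" for x
    proof -
      have xC: "x \<in> C" "x0 \<in> C" using x x0 X(1) by auto
      have p: "zmul (k x) (x - dproj A C' x) \<in> C'" "zmul (l x) (x0 - dproj A C' x0) \<in> C'"
        using dproj_in(2)[OF AC] xC *(3) zm.subspace_scale by blast+
      have "y x = zmul (k x) (x - dproj A C' x) - zmul (l x) (x0 - dproj A C' x0)"
        unfolding y_def using kl(2)[OF x] by (simp add: zm.scale_right_diff_distrib)
      then show ?thesis using p *(3) zm.subspace_diff by metis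
    qed
    let ?X = "X - {x0}"
    \<comment> \<open>A relation among the \<open>y x\<close> is rewritten over \<open>X\<close>:
      the coefficient of \<open>x0\<close> collects all its occurrences, every other one is
      multiplied by the non-zero \<open>k x\<close>.\<close>
    have fam: "d x = 0" if d: "(\<Sum>x\<in>?X. zmul (d x) (y x)) = 0" and x: "x \<in> ?X" for d x
    proof -
      define c where "c z = (if z = x0 then - (\<Sum>x\<in>?X. d x * l x) else d z * k z)" for z
      have "(\<Sum>z\<in>X. zmul (c z) z) = zmul (c x0) x0 + (\<Sum>z\<in>?X. zmul (c z) z)"
        using fin x0(1) by (rule sum.remove)
      also have "(\<Sum>z\<in>?X. zmul (c z) z) = (\<Sum>z\<in>?X. zmul (d z * k z) z)"
        by (rule sum.cong) (auto simp: c_def)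
      also have "zmul (c x0) x0 = - (\<Sum>z\<in>?X. zmul (d z * l z) x0)"
        by (simp add: c_def zm.scale_sum_left)
      also have "- (\<Sum>z\<in>?X. zmul (d z * l z) x0) + (\<Sum>z\<in>?X. zmul (d z * k z) z) = (\<Sum>x\<in>?X. zmul (d x) (y x))"
        by (simp add: y_def zm.scale_right_diff_distrib sum_subtractf)
      finally have "\<forall>z\<in>X. c z = 0" using ind d by simp
      then have "d x * k x = 0" using x unfolding c_def by auto
      then show ?thesis using kl(1) x by simp
    qed
    \<comment> \<open>\<open>z_independent\<close> speaks of sets, so independence of the family
      carries over to its image only once \<open>y\<close> is injective.\<close>
    have inj: "inj_on y ?X"
    proof (rule inj_onI, rule ccontr)
      fix a b assume ab: "a \<in> ?X" "b \<in> ?X" "y a = y b" "a \<noteq> b"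
      let ?c = "\<lambda>z. (if z = a then 1 else 0) - (if z = b then 1 else 0) :: int"
      have "zmul (?c z) (y z) = (if z = a then y a else 0) - (if z = b then y b else 0)" for z
        by (simp add: zm.scale_left_diff_distrib)
      then have "(\<Sum>x\<in>?X. zmul (?c x) (y x)) = y a - y b"
        using fin ab by (simp add: sum_subtractf)
      then have "?c a = 0" using fam[of ?c a] ab by simp
      then show False using ab(4) by simp
    qed
    have "z_independent (y ` ?X)" unfolding z_independent_def
    proof (intro conjI allI impI ballI)
      show "finite (y ` ?X)" using fin by simp
      fix c w assume "(\<Sum>x\<in>y ` ?X. zmul (c x) x) = 0" "w \<in> y ` ?X"
      then show "c w = 0" using fam[of "\<lambda>x. c (y x)"] by (auto simp: sum.reindex[OF inj])
    qed
    moreover have "y ` ?X \<subseteq> C'" using yC by blast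
    ultimately have "card (y ` ?X) \<le> n" by (intro n)
    then have "card ?X \<le> n" using card_image[OF inj] by simp
    then show ?thesis using x0(1) fin by (simp add: card_Diff_singleton)
  qed
  then show ?thesis unfolding finite_rank_def by blast
qed

lemma internal_direct_sum_subset:
  assumes "internal_direct_sum R \<A>" "A \<in> \<A>"
  shows "A \<subseteq> R"
proof
  fix a assume a: "a \<in> A"
  have "a = (\<Sum>B\<in>{A}. a) \<and> finite {A} \<and> {A} \<subseteq> \<A> \<and> (\<forall>B\<in>{A}. a \<in> B)" using a assms(2) by auto
  then have "\<exists>F x. a = (\<Sum>B\<in>F. x B) \<and> finite F \<and> F \<subseteq> \<A> \<and> (\<forall>B\<in>F. x B \<in> B)"
    by (intro exI[of _ "{A}"] exI[of _ "\<lambda>_. a"])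
  then show "a \<in> R" using assms(1) unfolding internal_direct_sum_def by blast
qed

text \<open>The summands are indexed by themselves, so \<open>A\<close> has to be a new member. The
  \<open>A\<close>-term of a vanishing sum is separated first, by directness of \<open>A\<close> and
  \<open>C'\<close>.\<close>

lemma internal_direct_sum_insert:
  assumes AC: "int_dsum C A C'" and ds: "internal_direct_sum C' \<A>" and nin: "A \<notin> \<A>"
  shows "internal_direct_sum C (insert A \<A>)"
proof -
  note * = int_dsumD[OF AC]
  have sg: "\<And>B. B \<in> \<A> \<Longrightarrow> is_subgroup B"
    and eq: "C' = {(\<Sum>B\<in>F. x B) | F x. finite F \<and> F \<subseteq> \<A> \<and> (\<forall>B\<in>F. x B \<in> B)}"
    and ind: "\<And>F x. finite F \<Longrightarrow> F \<subseteq> \<A> \<Longrightarrow> (\<And>B. B \<in> F \<Longrightarrow> x B \<in> B) \<Longrightarrow> (\<Sum>B\<in>F. x B) = 0 \<Longrightarrow> \<forall>B\<in>F. x B = 0"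
    using ds unfolding internal_direct_sum_def by blast+
  have sub: "B \<subseteq> C'" if "B \<in> \<A>" for B using internal_direct_sum_subset[OF ds that] .
  show ?thesis unfolding internal_direct_sum_def
  proof (intro conjI)
    show "\<forall>B\<in>insert A \<A>. is_subgroup B" using sg *(2) is_subgroup_iff by blast
    show "C = {(\<Sum>B\<in>F. x B) | F x. finite F \<and> F \<subseteq> insert A \<A> \<and> (\<forall>B\<in>F. x B \<in> B)}" (is "_ = ?S")
    proof (intro equalityI subsetI)
      fix z assume "z \<in> C"
      then obtain a c where ac: "a \<in> A" "c \<in> C'" "z = a + c" using *(7) by blast
      then obtain F x where Fx: "c = (\<Sum>B\<in>F. x B)" "finite F" "F \<subseteq> \<A>" "\<forall>B\<in>F. x B \<in> B" using eq by blast
      have AF: "A \<notin> F" using nin Fx(3) by blast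
      let ?x = "x(A := a)"
      have "(\<Sum>B\<in>insert A F. ?x B) = ?x A + (\<Sum>B\<in>F. ?x B)" using Fx(2) AF by simp
      also have "(\<Sum>B\<in>F. ?x B) = c" unfolding Fx(1) using AF by (intro sum.cong) auto
      finally have "z = (\<Sum>B\<in>insert A F. ?x B)" using ac by simp
      moreover have "finite (insert A F)" "insert A F \<subseteq> insert A \<A>" "\<forall>B\<in>insert A F. ?x B \<in> B"
        using Fx ac(1) by auto
      ultimately show "z \<in> ?S" by blast
    next
      fix z assume "z \<in> ?S"
      then obtain F x where Fx: "z = (\<Sum>B\<in>F. x B)" "finite F" "F \<subseteq> insert A \<A>" "\<forall>B\<in>F. x B \<in> B" by blast
      have "x B \<in> C" if "B \<in> F" for B using that Fx(3,4) sub *(4,5) by blast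
      then show "z \<in> C" unfolding Fx(1) by (intro zm.subspace_sum[OF *(1)])
    qed
    show "\<forall>F x. finite F \<and> F \<subseteq> insert A \<A> \<and> (\<forall>B\<in>F. x B \<in> B) \<and> (\<Sum>B\<in>F. x B) = 0 \<longrightarrow> (\<forall>B\<in>F. x B = 0)"
    proof (intro allI impI)
      fix F x assume F: "finite F \<and> F \<subseteq> insert A \<A> \<and> (\<forall>B\<in>F. x B \<in> B) \<and> (\<Sum>B\<in>F. x B) = 0"
      let ?F = "F - {A}"
      have F': "finite ?F" "?F \<subseteq> \<A>" "\<And>B. B \<in> ?F \<Longrightarrow> x B \<in> B" using F by auto
      have C': "(\<Sum>B\<in>?F. x B) \<in> C'" using F' sub by (intro zm.subspace_sum[OF *(3)]) blast
      have A0: "(A \<in> F \<longrightarrow> x A = 0) \<and> (\<Sum>B\<in>?F. x B) = 0"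
      proof (cases "A \<in> F")
        case True
        then have "x A + (\<Sum>B\<in>?F. x B) = 0" using F sum.remove[of F A x] by simp
        then show ?thesis using int_dsum_zero[OF AC _ C'] F True by blast
      next
        case False then show ?thesis using F by simp
      qed
      then have "\<forall>B\<in>?F. x B = 0" using ind F' by blast
      then show "\<forall>B\<in>F. x B = 0" using A0 by blast
    qed
  qed
qed

text \<open>\<open>fdec\<close> joins decomposability and finite rank, since both pass from a
  complement of a rank-one pure hull to the whole group. If it fails for \<open>R\<close>, it fails
  for every successive complement, so the splitting never stops. The resulting infinite sequence
  contradicts reducedness.\<close>

lemma splitting_reduced_decomposable:
  assumes spl: "splitting R" "torsion_free R" "reduced R"
  shows "fully_decomposable R \<and> finite_rank R"
proof -
  define fdec where "fdec C \<longleftrightarrow> (\<exists>\<A>. (\<forall>A\<in>\<A>. rank_one A) \<and> internal_direct_sum C \<A>) \<and> finite_rank C" for C :: "'a set"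
  have R: "zm.subspace R" using spl(1) unfolding splitting_def by blast
  have fdec0: "fdec {0}"
  proof -
    have "internal_direct_sum {0} ({} :: 'a set set)" unfolding internal_direct_sum_def by auto
    moreover have "finite_rank {0 :: 'a}" unfolding finite_rank_def
    proof (intro exI[of _ 1] allI impI)
      fix X :: "'a set" assume "X \<subseteq> {0} \<and> z_independent X"
      then have "card X \<le> card {0 :: 'a}" by (intro card_mono) auto
      then show "card X \<le> 1" by simp
    qed
    ultimately show ?thesis unfolding fdec_def by blast
  qed
  have fdec_step: "fdec C" if e: "e \<in> C" "e \<noteq> 0" and C: "C \<subseteq> R" "zm.subspace C"
    and AC: "int_dsum C (isolator C (zm.span {e})) C'" and C': "fdec C'" for C C' e
  proof -
    let ?A = "isolator C (zm.span {e})"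
    have tf: "torsion_free C" using spl(2) C(1) unfolding torsion_free_def by blast
    have A1: "rank_one ?A" by (rule rank_one_isolator[OF tf C(2) e])
    obtain \<A> where \<A>: "\<forall>A\<in>\<A>. rank_one A" "internal_direct_sum C' \<A>" "finite_rank C'"
      using C' unfolding fdec_def by blast
    have "?A \<notin> \<A>"
    proof
      assume "?A \<in> \<A>"
      then have "?A \<subseteq> C'" using internal_direct_sum_subset[OF \<A>(2)] by blast
      then have "?A \<subseteq> {0}" using int_dsumD(6)[OF AC] by blast
      then have "?A = {0}" using zm.subspace_0[OF int_dsumD(2)[OF AC]] by blast
      then show False using A1 unfolding rank_one_def by blast
    qed
    then have "internal_direct_sum C (insert ?A \<A>)" by (rule internal_direct_sum_insert[OF AC \<A>(2)])
    moreover have "finite_rank C"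
    proof (rule finite_rank_extend[OF AC \<A>(3)])
      fix a b assume ab: "a \<in> ?A" "b \<in> ?A" "a \<noteq> 0"
      obtain k l where a: "k \<noteq> 0" "zmul k a = zmul l e" using ab(1) unfolding isolator_def zm.span_singleton by blast
      obtain k' l' where b: "k' \<noteq> 0" "zmul k' b = zmul l' e" using ab(2) unfolding isolator_def zm.span_singleton by blast
      have "l \<noteq> 0"
      proof
        assume "l = 0"
        then have "zmul k a = 0" using a by simp
        then show False using torsion_freeD[OF tf] ab(1,3) a(1) unfolding isolator_def by blast
      qed
      moreover have "zmul (l * k') b = zmul (l' * k) a" using a b by (metis zm.scale_scale mult.commute)
      ultimately show "\<exists>k l. k \<noteq> 0 \<and> zmul k b = zmul l a" using b(1) by (intro exI[of _ "l * k'"] exI[of _ "l' * k"]) auto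
    qed
    ultimately show ?thesis using A1 \<A>(1) unfolding fdec_def by blast
  qed
  have "fdec R"
  proof (rule ccontr)
    assume nf: "\<not> fdec R"
    \<comment> \<open>A pair consists of the summand that remains and the element whose pure hull is
      split off next.\<close>
    define P where "P p \<longleftrightarrow> splitting (fst p) \<and> fst p \<subseteq> R \<and> \<not> fdec (fst p) \<and> snd p \<in> fst p \<and> snd p \<noteq> 0" for p :: "'a set \<times> 'a"
    define Q where "Q p q \<longleftrightarrow> int_dsum (fst p) (isolator (fst p) (zm.span {snd p})) (fst q)" for p q :: "'a set \<times> 'a"
    have pick: "\<exists>e. e \<in> C \<and> e \<noteq> 0" if "\<not> fdec C" "splitting C" for C
    proof (rule ccontr)
      assume "\<nexists>e. e \<in> C \<and> e \<noteq> 0"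
      moreover have "0 \<in> C" using that(2) zm.subspace_0 unfolding splitting_def by blast
      ultimately have "C = {0}" by blast
      then show False using that(1) fdec0 by simp
    qed
    have "\<exists>f. \<forall>n::nat. P (f n) \<and> Q (f n) (f (Suc n))"
    proof (rule dependent_nat_choice)
      obtain e where "e \<in> R" "e \<noteq> 0" using pick[OF nf spl(1)] by blast
      then show "\<exists>x. P x" unfolding P_def using spl(1) nf by (intro exI[of _ "(R, e)"]) auto
    next
      fix p and n :: nat assume p: "P p"
      obtain C e where pe: "p = (C, e)" by force
      have C: "splitting C" "C \<subseteq> R" "\<not> fdec C" "e \<in> C" "e \<noteq> 0" using p unfolding P_def pe by auto
      have C': "zm.subspace C" using C(1) unfolding splitting_def by blast
      have tf: "torsion_free C" using spl(2) C(2) unfolding torsion_free_def by blast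
      obtain C1 where C1: "int_dsum C (isolator C (zm.span {e})) C1"
        using C(1) isolated_isolator[OF C' zm.subspace_span] unfolding splitting_def by blast
      have "\<not> fdec C1" using fdec_step[OF C(4,5,2) C' C1] C(3) by blast
      moreover have "splitting C1" by (rule splitting_summand[OF C(1) tf C1])
      moreover have "C1 \<subseteq> R" using int_dsumD(5)[OF C1] C(2) by blast
      moreover obtain e1 where "e1 \<in> C1" "e1 \<noteq> 0" using pick calculation by blast
      ultimately show "\<exists>q. P q \<and> Q p q" unfolding P_def Q_def pe using C1 by (intro exI[of _ "(C1, e1)"]) auto
    qed
    then obtain f where f: "\<And>n. P (f n)" "\<And>n. Q (f n) (f (Suc n))" by blast
    define C where "C n = fst (f n)" for n
    define e where "e n = snd (f n)" for n
    have C: "C n \<subseteq> R" "e n \<in> C n" "e n \<noteq> 0" and AC: "int_dsum (C n) (isolator (C n) (zm.span {e n})) (C (Suc n))" for n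
      using f[of n] unfolding P_def Q_def C_def e_def by auto
    note sC = int_dsumD(1)[OF AC] and anti = int_dsumD(5)[OF AC]
    have eR: "e n \<in> R" for n using C by blast
    have tf: "k = 0" if "zmul k (e n) = 0" for k n
      using torsion_freeD[OF spl(2) eR that] C(3) by blast
    have meet0: "k = 0" if k: "zmul k (e n) \<in> C (Suc n)" for k n
    proof -
      have "e n \<in> isolator (C n) (zm.span {e n})"
        unfolding isolator_def using C(2) zm.span_base[of "e n" "{e n}"] by (intro CollectI conjI exI[of _ 1]) auto
      then have "zmul k (e n) \<in> isolator (C n) (zm.span {e n})"
        using int_dsumD(2)[OF AC] zm.subspace_scale by blast
      then have "zmul k (e n) = 0" using int_dsumD(6)[OF AC] k by blast
      then show ?thesis by (rule tf)
    qed
    \<comment> \<open>The elements \<open>e 0, ..., e n\<close> stay independent modulo what remains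
      after splitting them off.\<close>
    have meet: "x = 0" if "x \<in> zm.span (e ` {..n})" "x \<in> C (Suc n)" for n x
      using that
    proof (induction n arbitrary: x)
      case 0
      then obtain k where k: "x = zmul k (e 0)" by (auto simp: zm.span_singleton)
      then have "k = 0" using meet0[of k 0] 0(2) by simp
      then show ?case using k by simp
    next
      case (Suc n)
      have "e ` {..Suc n} = insert (e (Suc n)) (e ` {..n})" by (simp add: atMost_Suc)
      then obtain k where k: "x - zmul k (e (Suc n)) \<in> zm.span (e ` {..n})"
        using Suc.prems(1) by (auto simp: zm.span_insert)
      have "x \<in> C (Suc n)" using Suc.prems(2) anti by blast
      then have "x - zmul k (e (Suc n)) \<in> C (Suc n)"
        using C(2) by (intro zm.subspace_diff[OF sC] zm.subspace_scale[OF sC])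
      then have "x - zmul k (e (Suc n)) = 0" using Suc.IH k by blast
      then have x: "x = zmul k (e (Suc n))" by simp
      then have "k = 0" using meet0 Suc.prems(2) by blast
      then show ?case using x by simp
    qed
    \<comment> \<open>Modulo these elements \<open>e 0\<close> is divisible by every factorial, as in the presentation of the rationals.\<close>
    define g where "g i = e i - zmul (int (i + 2)) (e (Suc i))" for i
    have g_e: "zm.span (g ` {..<n}) \<subseteq> zm.span (e ` {..n})" for n
    proof (rule zm.span_minimal[OF _ zm.subspace_span], rule subsetI)
      fix x assume "x \<in> g ` {..<n}"
      then obtain i where i: "i < n" "x = g i" by blast
      then have "e i \<in> zm.span (e ` {..n})" "e (Suc i) \<in> zm.span (e ` {..n})" by (auto intro!: zm.span_base)
      then show "x \<in> zm.span (e ` {..n})" unfolding i(2) g_def by (intro zm.span_diff zm.span_scale)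
    qed
    \<comment> \<open>Among the first generators only the last, \<open>g n\<close>, involves
      \<open>e (Suc n)\<close>. Its coefficient \<open>c\<close> must therefore vanish, and the
      induction goes down to the empty set of generators.\<close>
    have e0: "m = 0" if "zmul m (e 0) \<in> zm.span (g ` {..<n})" for m n
      using that
    proof (induction n)
      case 0
      then show ?case using tf by simp
    next
      case (Suc n)
      have "g ` {..<Suc n} = insert (g n) (g ` {..<n})" by (simp add: lessThan_Suc)
      then obtain c where c: "zmul m (e 0) - zmul c (g n) \<in> zm.span (g ` {..<n})"
        using Suc.prems by (auto simp: zm.span_insert)
      let ?w = "zmul m (e 0) - zmul c (g n)"
      have "?w \<in> zm.span (e ` {..n})" using c g_e by blast
      moreover have "zmul m (e 0) \<in> zm.span (e ` {..n})" "zmul c (e n) \<in> zm.span (e ` {..n})"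
        by (rule zm.span_scale, rule zm.span_base, simp)+
      ultimately have "?w - zmul m (e 0) + zmul c (e n) \<in> zm.span (e ` {..n})"
        by (rule zm.span_add[OF zm.span_diff])
      moreover have eq: "?w - zmul m (e 0) + zmul c (e n) = zmul (c * int (n + 2)) (e (Suc n))"
        unfolding g_def by (simp add: zm.scale_right_diff_distrib)
      moreover have "zmul (c * int (n + 2)) (e (Suc n)) \<in> C (Suc n)" using C(2) zm.subspace_scale[OF sC] by blast
      ultimately have "zmul (c * int (n + 2)) (e (Suc n)) = 0" using meet by metis
      then have "c = 0" using tf by fastforce
      then show ?case using Suc.IH c by simp
    qed
    have union: "\<exists>n. x \<in> zm.span (g ` {..<n})" if "x \<in> zm.span (range g)" for x
      using that
    proof (induction rule: zm.span_induct_alt)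
      case base
      then show ?case using zm.span_zero by blast
    next
      case (step c x y)
      obtain i where "x = g i" using step by blast
      obtain n where "y \<in> zm.span (g ` {..<n})" using step by blast
      then have "y \<in> zm.span (g ` {..<max n (Suc i)})" using zm.span_mono[of "g ` {..<n}" "g ` {..<max n (Suc i)}"] image_mono[of "{..<n}" "{..<max n (Suc i)}" g] by auto
      moreover have "x \<in> zm.span (g ` {..<max n (Suc i)})" unfolding \<open>x = g i\<close> by (rule zm.span_base) auto
      ultimately show ?case using zm.span_add zm.span_scale by blast
    qed
    \<comment> \<open>The projection along this summand kills every \<open>g i\<close>, so it turns
      \<open>e i\<close> into \<open>i + 2\<close> times the image of \<open>e (Suc i)\<close>.
      Reducedness forces the image of \<open>e 0\<close> to be 0, which places a non-zero multiple
      of \<open>e 0\<close> in the span of the \<open>g i\<close>.\<close>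
    let ?K = "isolator R (zm.span (range g))"
    have "isolated_in ?K R" by (rule isolated_isolator[OF R zm.subspace_span])
    then obtain L where "int_dsum R ?K L" using spl(1) unfolding splitting_def by blast
    then have LK: "int_dsum R L ?K" by (rule int_dsum_commute)
    let ?pi = "dproj L ?K"
    have gR: "g i \<in> R" for i unfolding g_def using eR R by (intro zm.subspace_diff zm.subspace_scale)
    then have "zm.span (range g) \<subseteq> R" using R by (intro zm.span_minimal) auto
    then have gK: "g i \<in> ?K" for i using isolator_superset zm.span_base[of "g i" "range g"] by blast
    have pi_step: "?pi (e i) = zmul (int (i + 2)) (?pi (e (Suc i)))" for i
    proof -
      have "e i = g i + zmul (int (i + 2)) (e (Suc i))" unfolding g_def by simp
      then have "?pi (e i) = ?pi (g i) + ?pi (zmul (int (i + 2)) (e (Suc i)))"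
        using dproj_add[OF LK gR zm.subspace_scale[OF R eR]] by metis
      then show ?thesis using dproj_0[OF LK gK] dproj_zmul[OF LK eR] by simp
    qed
    \<comment> \<open>The factors \<open>2, ..., n + 1\<close> accumulate to
      \<open>fact (Suc n)\<close>.\<close>
    have pi_fact: "?pi (e 0) = zmul (fact (Suc n)) (?pi (e n))" for n
    proof (induction n)
      case (Suc n)
      have "fact (Suc (Suc n)) = fact (Suc n) * int (n + 2)" by (simp add: algebra_simps)
      then have "zmul (fact (Suc (Suc n))) (?pi (e (Suc n))) = zmul (fact (Suc n)) (?pi (e n))"
        unfolding pi_step[of n] by (simp only: zm.scale_scale)
      then show ?case by (rule trans[OF Suc.IH sym])
    qed simp
    have piR: "?pi (e n) \<in> R" for n using dproj_in(1)[OF LK eR] int_dsumD(4)[OF LK] by blast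
    have "divides_in R n (?pi (e 0))" if "n \<noteq> 0" for n
    proof -
      have "nat \<bar>n\<bar> dvd fact (Suc (nat \<bar>n\<bar>))" using that by (intro dvd_fact) auto
      then have "n dvd fact (Suc (nat \<bar>n\<bar>))" by (metis abs_dvd_iff abs_ge_zero int_dvd_int_iff int_nat_eq of_nat_fact)
      moreover have "divides_in R (fact (Suc (nat \<bar>n\<bar>))) (?pi (e 0))"
        unfolding divides_in_def using pi_fact[of "nat \<bar>n\<bar>"] piR by metis
      ultimately show ?thesis using divides_in_dvd[OF R] by blast
    qed
    then have "?pi (e 0) = 0" using spl(3) piR unfolding reduced_def by blast
    then have "e 0 \<in> ?K" using dproj_in(2)[OF LK eR[of 0]] by simp
    then obtain m where m: "m \<noteq> 0" "zmul m (e 0) \<in> zm.span (range g)" unfolding isolator_def by blast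
    then show False using union[OF m(2)] e0 by blast
  qed
  then show ?thesis unfolding fdec_def fully_decomposable_def using spl(2) by blast
qed

section \<open>Homogeneous fully decomposable groups of finite rank\<close>

text \<open>\<open>F / P\<close> is finitely generated and torsion-free, hence free, so
  \<open>P\<close> splits off. The induction does this directly: the pure hull \<open>P'\<close> of
  \<open>P\<close> and one generator \<open>x\<close> is a summand of \<open>F\<close>, and
  \<open>P'\<close> is shown to be \<open>P\<close> plus a cyclic group.\<close>

lemma finitely_generated_summand:
  assumes "finite X" "isolated_in P F" "zm.subspace F" "F = zm.span (P \<union> X)"
  shows "\<exists>K. int_dsum F P K"
  using assms
proof (induction X arbitrary: P rule: finite_induct)
  case empty
  then have P: "zm.subspace P" unfolding isolated_in_def by blast
  then have "F = P" using empty(3) zm.span_eq_iff[of P] by simp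
  then have "int_dsum F P {0}" using P unfolding int_dsum_iff
    by (auto simp: zm.subspace_0)
  then show ?case by blast
next
  case (insert x X)
  have P: "zm.subspace P" "P \<subseteq> F" and iso: "\<And>z n. z \<in> F \<Longrightarrow> n \<noteq> 0 \<Longrightarrow> zmul n z \<in> P \<Longrightarrow> z \<in> P"
    using insert.prems(1) unfolding isolated_in_def by auto
  show ?case
  proof (cases "x \<in> P")
    case True
    then have "F = zm.span (P \<union> X)" using insert.prems(3) by (simp add: insert_absorb)
    then show ?thesis using insert.IH insert.prems by blast
  next
    case False
    have gF: "x \<in> F" "X \<subseteq> F" using insert.prems(3) zm.span_superset[of "P \<union> insert x X"] by auto
    define P' where "P' = isolator F (zm.span (insert x P))"
    have P': "isolated_in P' F" "zm.subspace P'" "P' \<subseteq> F"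
      unfolding P'_def using isolated_isolator[OF insert.prems(2) zm.subspace_span]
      by (auto simp: isolated_in_def)
    have "zm.span (insert x P) \<subseteq> F" using gF P insert.prems(2) by (intro zm.span_minimal) auto
    then have sub: "insert x P \<subseteq> P'"
      unfolding P'_def by (rule order_trans[OF zm.span_superset isolator_superset])
    have "F = zm.span (P' \<union> X)"
    proof
      show "F \<subseteq> zm.span (P' \<union> X)" unfolding insert.prems(3) using sub by (intro zm.span_mono) auto
      show "zm.span (P' \<union> X) \<subseteq> F" using P' gF insert.prems(2) by (intro zm.span_minimal) auto
    qed
    then obtain K where K: "int_dsum F P' K" using insert.IH[OF P'(1) insert.prems(2)] by blast
    let ?r = "dproj P' K"
    have rP': "?r z \<in> P'" if "z \<in> F" for z using dproj_in(1)[OF K that] .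
    have "\<exists>n m. n \<noteq> 0 \<and> zmul n (?r z) - zmul m x \<in> P" if z: "z \<in> F" for z
      using rP'[OF z] mem_span_insert[OF P(1), of _ x] unfolding P'_def isolator_def by blast
    then obtain n m where nm: "\<And>z. z \<in> F \<Longrightarrow> n z \<noteq> 0" "\<And>z. z \<in> F \<Longrightarrow> zmul (n z) (?r z) - zmul (m z) x \<in> P"
      by metis
    \<comment> \<open>A common multiplier for the finitely many generators, which brings their
      projections into \<open>P\<close> plus multiples of \<open>x\<close>.\<close>
    define N where "N = (\<Prod>z\<in>insert x X. n z)"
    have N: "N \<noteq> 0" unfolding N_def using insert.hyps(1) nm(1) gF by (auto simp: prod_zero_iff subset_iff)
    \<comment> \<open>\<open>W\<close> is a subgroup containing all generators, so \<open>N\<close>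
      serves for the whole of \<open>F\<close>, in particular for \<open>P'\<close>.\<close>
    define W where "W = {z\<in>F. \<exists>m. zmul N (?r z) - zmul m x \<in> P}"
    have W: "zm.subspace W"
    proof (rule zm.subspaceI)
      have "?r 0 = 0" using dproj_0[OF K zm.subspace_0[OF int_dsumD(3)[OF K]]] .
      then show "0 \<in> W" unfolding W_def using zm.subspace_0[OF insert.prems(2)] zm.subspace_0[OF P(1)]
        by (intro CollectI conjI exI[of _ 0]) auto
    next
      fix a b assume "a \<in> W" "b \<in> W"
      then obtain k l where ab: "a \<in> F" "b \<in> F" "zmul N (?r a) - zmul k x \<in> P" "zmul N (?r b) - zmul l x \<in> P"
        unfolding W_def by blast
      have "zmul N (?r (a + b)) - zmul (k + l) x = (zmul N (?r a) - zmul k x) + (zmul N (?r b) - zmul l x)"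
        using dproj_add[OF K ab(1,2)] by (simp add: zm.scale_right_distrib zm.scale_left_distrib)
      then have "zmul N (?r (a + b)) - zmul (k + l) x \<in> P" using zm.subspace_add[OF P(1) ab(3,4)] by simp
      then show "a + b \<in> W" unfolding W_def using zm.subspace_add[OF insert.prems(2) ab(1,2)] by blast
    next
      fix a j assume "a \<in> W"
      then obtain k where a: "a \<in> F" "zmul N (?r a) - zmul k x \<in> P" unfolding W_def by blast
      have "zmul N (?r (zmul j a)) - zmul (j * k) x = zmul j (zmul N (?r a) - zmul k x)"
        using dproj_zmul[OF K a(1)] by (simp add: zm.scale_right_diff_distrib mult.commute)
      then have "zmul N (?r (zmul j a)) - zmul (j * k) x \<in> P" using zm.subspace_scale[OF P(1) a(2)] by simp
      then show "zmul j a \<in> W" unfolding W_def using zm.subspace_scale[OF insert.prems(2) a(1)] by blast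
    qed
    have "P \<subseteq> W"
    proof
      fix z assume z: "z \<in> P"
      then have "?r z = z" using dproj_id[OF K] sub by blast
      then have "zmul N (?r z) - zmul 0 x \<in> P" using zm.subspace_scale[OF P(1) z] by simp
      then show "z \<in> W" unfolding W_def using z P(2) by blast
    qed
    moreover have "insert x X \<subseteq> W"
    proof
      fix z assume z: "z \<in> insert x X"
      then have zF: "z \<in> F" using gF by blast
      have "n z dvd N" unfolding N_def using insert.hyps(1) z by (intro dvd_prodI) auto
      then obtain q where q: "N = q * n z" by (metis dvdE mult.commute)
      have "zmul N (?r z) - zmul (q * m z) x = zmul q (zmul (n z) (?r z) - zmul (m z) x)"
        unfolding q by (simp add: zm.scale_right_diff_distrib)
      then have "zmul N (?r z) - zmul (q * m z) x \<in> P" using zm.subspace_scale[OF P(1) nm(2)[OF zF]] by simp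
      then show "z \<in> W" unfolding W_def using zF by blast
    qed
    ultimately have "F \<subseteq> W" unfolding insert.prems(3) using W by (intro zm.span_minimal) auto
    then have mult: "\<exists>m. zmul N y - zmul m x \<in> P" if "y \<in> P'" for y
      using dproj_id[OF K that] that P'(3) unfolding W_def by fastforce
    \<comment> \<open>The ideal of the \<open>x\<close>-coefficients of \<open>N y\<close>. It
      contains \<open>N\<close>, so its generator \<open>d\<close> is non-zero; an element
      \<open>w\<close> with coefficient \<open>d\<close> generates the cyclic complement.\<close>
    define I where "I = {m. \<exists>y\<in>P'. zmul N y - zmul m x \<in> P}"
    have NI: "N \<in> I" unfolding I_def using sub zm.subspace_0[OF P(1)] by (intro CollectI bexI[of _ x]) auto
    obtain d where d: "d \<in> I" "\<And>m. m \<in> I \<Longrightarrow> d dvd m"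
    proof (rule int_ideal_principal[of I])
      show "0 \<in> I" unfolding I_def using zm.subspace_0[OF P(1)] zm.subspace_0[OF P'(2)]
        by (intro CollectI bexI[of _ 0]) auto
    next
      fix a b assume "a \<in> I" "b \<in> I"
      then obtain y z where yz: "y \<in> P'" "z \<in> P'" "zmul N y - zmul a x \<in> P" "zmul N z - zmul b x \<in> P"
        unfolding I_def by blast
      have "zmul N (y - z) - zmul (a - b) x = (zmul N y - zmul a x) - (zmul N z - zmul b x)"
        by (simp add: zm.scale_right_diff_distrib zm.scale_left_diff_distrib)
      then have "zmul N (y - z) - zmul (a - b) x \<in> P" using zm.subspace_diff[OF P(1) yz(3,4)] by simp
      then show "a - b \<in> I" unfolding I_def using zm.subspace_diff[OF P'(2) yz(1,2)] by blast
    next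
      fix a k assume "a \<in> I"
      then obtain y where y: "y \<in> P'" "zmul N y - zmul a x \<in> P" unfolding I_def by blast
      have "zmul N (zmul k y) - zmul (k * a) x = zmul k (zmul N y - zmul a x)"
        by (simp add: zm.scale_right_diff_distrib mult.commute)
      then have "zmul N (zmul k y) - zmul (k * a) x \<in> P" using zm.subspace_scale[OF P(1) y(2)] by simp
      then show "k * a \<in> I" unfolding I_def using zm.subspace_scale[OF P'(2) y(1)] by blast
    qed blast
    have "d \<noteq> 0" using d(2)[OF NI] N by auto
    obtain w where w: "w \<in> P'" "zmul N w - zmul d x \<in> P" using d(1) unfolding I_def by blast
    have "int_dsum P' P (zm.span {w})" unfolding int_dsum_iff
    proof (intro conjI ballI)
      show "zm.subspace P" "zm.subspace (zm.span {w})" "P \<subseteq> P'" "zm.subspace P'" using P P' sub by auto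
      show "zm.span {w} \<subseteq> P'" using w(1) P'(2) by (intro zm.span_minimal) auto
      show "P \<inter> zm.span {w} \<subseteq> {0}"
      proof
        fix z assume z: "z \<in> P \<inter> zm.span {w}"
        then obtain k where k: "z = zmul k w" unfolding zm.span_singleton by blast
        have "k = 0"
        proof (rule ccontr)
          assume "k \<noteq> 0"
          then have "w \<in> P" using iso[of w k] w(1) P'(3) z k by blast
          then have "zmul N w - (zmul N w - zmul d x) \<in> P"
            by (rule zm.subspace_diff[OF P(1) zm.subspace_scale[OF P(1)] w(2)])
          then have "zmul d x \<in> P" by simp
          then show False using iso[OF gF(1) \<open>d \<noteq> 0\<close>] False by blast
        qed
        then show "z \<in> {0}" using k by simp
      qed
      fix y assume y: "y \<in> P'"
      then obtain m where m: "zmul N y - zmul m x \<in> P" using mult by blast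
      then have "m \<in> I" unfolding I_def using y by blast
      then obtain k where k: "m = k * d" using d(2) by (metis dvdE mult.commute)
      \<comment> \<open>Subtracting \<open>k w\<close> removes the \<open>x\<close>-coefficient, and
        isolation of \<open>P\<close> then cancels \<open>N\<close>.\<close>
      have "zmul N (y - zmul k w) = (zmul N y - zmul m x) - zmul k (zmul N w - zmul d x)"
        unfolding k by (simp add: zm.scale_right_diff_distrib mult.commute)
      then have "zmul N (y - zmul k w) \<in> P" using m w(2) P(1) by (metis zm.subspace_diff zm.subspace_scale)
      moreover have "y - zmul k w \<in> F" using y w(1) P' by (meson subsetD zm.subspace_diff zm.subspace_scale)
      ultimately have "y - zmul k w \<in> P" using iso N by blast
      moreover have "zmul k w \<in> zm.span {w}" unfolding zm.span_singleton by blast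
      ultimately show "\<exists>b\<in>P. \<exists>c\<in>zm.span {w}. y = b + c"
        by (intro bexI[of _ "y - zmul k w"] bexI[of _ "zmul k w"]) auto
    qed
    then show ?thesis using int_dsum_assoc[OF K] by blast
  qed
qed

lemma rank_one_dependent:
  assumes "rank_one A" "a \<in> A" "b \<in> A" "a \<noteq> 0"
  obtains k l where "k \<noteq> 0" "zmul k b = zmul l a"
\<comment> \<open>When \<open>a = b\<close> the set \<open>{a, b}\<close> has one element and its
  dependence gives nothing.\<close>
proof (cases "a = b")
  case True
  then show ?thesis using that[of 1 1] by simp
next
  case False
  have "\<not> z_independent {a, b}"
  proof
    assume "z_independent {a, b}"
    moreover have "{a, b} \<subseteq> A" using assms(2,3) by simp
    ultimately have "card {a, b} \<le> 1" using assms(1) unfolding rank_one_def by simp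
    then show False using False by simp
  qed
  then obtain c where c: "zmul (c a) a + zmul (c b) b = 0" "c a \<noteq> 0 \<or> c b \<noteq> 0"
    using False unfolding z_independent_def by auto
  have "c b \<noteq> 0"
  proof
    assume *: "c b = 0"
    then have "zmul (c a) a = 0" using c(1) by simp
    then show False using torsion_freeD[of A a "c a"] assms c(2) * unfolding rank_one_def by blast
  qed
  moreover have "zmul (c b) b = zmul (- c a) a" using c(1) by (simp add: eq_neg_iff_add_eq_0 add.commute)
  ultimately show ?thesis using that by blast
qed

text \<open>Non-zero elements chosen from distinct summands are independent, so their number is
  bounded by the rank.\<close>

lemma finite_summands:
  assumes ds: "internal_direct_sum R \<A>" and r1: "\<And>A. A \<in> \<A> \<Longrightarrow> rank_one A" and fr: "finite_rank R"
  shows "finite \<A>"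
proof (rule ccontr)
  assume "infinite \<A>"
  obtain n where n: "\<And>X. X \<subseteq> R \<Longrightarrow> z_independent X \<Longrightarrow> card X \<le> n" using fr unfolding finite_rank_def by blast
  obtain F where F: "finite F" "card F = Suc n" "F \<subseteq> \<A>"
    using infinite_arbitrarily_large[OF \<open>infinite \<A>\<close>] by blast
  have "\<exists>a. a \<in> A \<and> a \<noteq> 0" if "A \<in> F" for A
  proof -
    have "rank_one A" using r1 F(3) that by blast
    then show ?thesis unfolding rank_one_def is_subgroup_def by blast
  qed
  then obtain a where a: "\<And>A. A \<in> F \<Longrightarrow> a A \<in> A" "\<And>A. A \<in> F \<Longrightarrow> a A \<noteq> 0" by metis
  have ind: "\<forall>A\<in>F. x A = 0" if "\<And>A. A \<in> F \<Longrightarrow> x A \<in> A" "(\<Sum>A\<in>F. x A) = 0" for x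
    using ds F(1,3) that unfolding internal_direct_sum_def by blast
  have sub: "zm.subspace A" if "A \<in> F" for A
    using r1[of A] F(3) that unfolding rank_one_def is_subgroup_iff by blast
  have ind': "c A = 0" if c: "(\<Sum>A\<in>F. zmul (c A) (a A)) = 0" and A: "A \<in> F" for c A
  proof -
    have "zmul (c A) (a A) \<in> A" if "A \<in> F" for A using a(1) sub that zm.subspace_scale by blast
    then have "zmul (c A) (a A) = 0" using ind[of "\<lambda>A. zmul (c A) (a A)"] c A by blast
    moreover have "torsion_free A" using r1 F(3) A unfolding rank_one_def by blast
    ultimately show ?thesis using torsion_freeD a A by blast
  qed
  have inj: "inj_on a F"
  proof (rule inj_onI, rule ccontr)
    fix A B assume AB: "A \<in> F" "B \<in> F" "a A = a B" "A \<noteq> B"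
    let ?c = "\<lambda>Z. (if Z = A then 1 else 0) - (if Z = B then 1 else 0) :: int"
    have "zmul (?c Z) (a Z) = (if Z = A then a A else 0) - (if Z = B then a B else 0)" for Z
      by (simp add: zm.scale_left_diff_distrib)
    then have "(\<Sum>Z\<in>F. zmul (?c Z) (a Z)) = a A - a B"
      using F(1) AB by (simp add: sum_subtractf)
    then have "?c A = 0" using ind'[of ?c A] AB by simp
    then show False using AB(4) by simp
  qed
  have "z_independent (a ` F)" unfolding z_independent_def
  proof (intro conjI allI impI ballI)
    show "finite (a ` F)" using F(1) by simp
    fix c w assume "(\<Sum>x\<in>a ` F. zmul (c x) x) = 0" "w \<in> a ` F"
    then show "c w = 0" using ind'[of "\<lambda>A. c (a A)"] by (auto simp: sum.reindex[OF inj])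
  qed
  moreover have "a ` F \<subseteq> R" using a(1) F(3) internal_direct_sum_subset[OF ds] by blast
  ultimately have "card (a ` F) \<le> n" using n by blast
  then show False using F(2) card_image[OF inj] by simp
qed

text \<open>The type of an element determines its heights up to finitely many finite changes. The
  induction is on the number of primes at which the heights of \<open>x\<close> and \<open>y\<close>
  differ; each step corrects one prime by replacing \<open>y\<close> with a rational
  multiple.\<close>

lemma same_type_adjust:
  assumes tf: "torsion_free R" and R: "zm.subspace R" and x: "x \<in> R"
    and "y \<in> R" "y \<noteq> 0" "same_type R x y"
  shows "\<exists>y'\<in>R. y' \<noteq> 0 \<and> (\<exists>k l. k \<noteq> 0 \<and> l \<noteq> 0 \<and> zmul k y' = zmul l y) \<and>
    (\<forall>m>0. divides_in R (int m) x \<longleftrightarrow> divides_in R (int m) y')"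
  using assms(4-)
proof (induction "card {p. prime p \<and> height R p x \<noteq> height R p y}" arbitrary: y)
  case 0
  then have "{p. prime p \<and> height R p x \<noteq> height R p y} = {}" unfolding same_type_def by simp
  then have eq: "divides_in R (int p ^ k) x \<longleftrightarrow> divides_in R (int p ^ k) y" if "prime p" for p k
    using that height_ge_iff[OF R x, of k p] height_ge_iff[OF R 0(2), of k p] by auto
  have "divides_in R (int m) x \<longleftrightarrow> divides_in R (int m) y" if "m > 0" for m
    using divides_in_of_prime_powers[OF R, of y x m] divides_in_of_prime_powers[OF R, of x y m] eq that x 0(2) by blast
  then show ?case using 0(2,3) by (intro bexI[of _ y] conjI exI[of _ 1]) auto
next
  case (Suc n)
  let ?D = "\<lambda>y. {p. prime p \<and> height R p x \<noteq> height R p y}"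
  have fin: "finite (?D y)" using Suc.prems(3) unfolding same_type_def by blast
  have "?D y \<noteq> {}" using Suc.hyps(2) by (metis card.empty nat.distinct(1))
  then obtain p where p: "p \<in> ?D y" by blast
  then have pp: "prime p" by simp
  obtain a b where ab: "height R p x = enat a" "height R p y = enat b"
    using p Suc.prems(3) unfolding same_type_def by (metis (mono_tags, lifting) mem_Collect_eq not_infinity_eq)
  let ?p = "int p"
  have p0: "?p \<noteq> 0" using pp by auto
  obtain y0 where y0: "y0 \<in> R" "zmul (?p ^ b) y0 = y"
    using height_ge_iff[OF R Suc.prems(1), of b p] ab(2) unfolding divides_in_def by auto
  have ndvd: "\<not> divides_in R ?p y0"
  proof
    assume "divides_in R ?p y0"
    then obtain u where "u \<in> R" "zmul ?p u = y0" unfolding divides_in_def by blast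
    then have "zmul (?p ^ Suc b) u = y" using y0(2) by (metis power_Suc2 zm.scale_scale)
    then have "enat (Suc b) \<le> height R p y"
      using height_ge_iff[OF R Suc.prems(1), of "Suc b" p] \<open>u \<in> R\<close> unfolding divides_in_def by blast
    then show False using ab(2) by simp
  qed
  \<comment> \<open>\<open>y0\<close> has \<open>p\<close>-height 0, so \<open>y1\<close> has the
    \<open>p\<close>-height \<open>a\<close> of \<open>x\<close>, while its heights at the other
    primes are those of \<open>y\<close>.\<close>
  define y1 where "y1 = zmul (?p ^ a) y0"
  have y1: "y1 \<in> R" unfolding y1_def using y0(1) R zm.subspace_scale by blast
  have rel: "zmul (?p ^ b) y1 = zmul (?p ^ a) y"
    unfolding y1_def y0(2)[symmetric] by (rule zm.scale_left_commute)
  have "y1 \<noteq> 0"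
  proof
    assume "y1 = 0"
    then have "zmul (?p ^ a) y = 0" using rel by simp
    then show False using torsion_freeD[OF tf Suc.prems(1), of "?p ^ a"] p0 Suc.prems(2) by simp
  qed
  have hq: "height R q y1 = height R q y" if "prime q" "q \<noteq> p" for q
  proof -
    have "divides_in R (int q ^ k) (zmul (?p ^ j) y0) \<longleftrightarrow> divides_in R (int q ^ k) y0" for k j
    proof -
      have "coprime (int q ^ k) (?p ^ j)" using primes_coprime[OF that(1) pp that(2)] by simp
      then show ?thesis using divides_in_cancel_coprime[OF R y0(1)] divides_in_zmul[OF R] by blast
    qed
    then have "divides_in R (int q ^ k) y1 \<longleftrightarrow> divides_in R (int q ^ k) y" for k
      unfolding y1_def using y0(2) by metis
    then have "enat k \<le> height R q y1 \<longleftrightarrow> enat k \<le> height R q y" for k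
      using height_ge_iff[OF R y1] height_ge_iff[OF R Suc.prems(1)] by simp
    then show ?thesis by (meson enat_le_iff order_antisym)
  qed
  have hp: "height R p y1 = enat a"
  proof (rule order_antisym)
    show "enat a \<le> height R p y1"
      using height_ge_iff[OF R y1, of a p] divides_in_self_mult[OF y0(1) R, of "?p ^ a"] by (simp add: y1_def)
    show "height R p y1 \<le> enat a"
    proof (rule ccontr)
      assume "\<not> height R p y1 \<le> enat a"
      then have "enat (Suc a) \<le> height R p y1" by (metis Suc_ile_eq not_le)
      then have "divides_in R (?p ^ a * ?p) (zmul (?p ^ a) y0)"
        using height_ge_iff[OF R y1, of "Suc a" p] by (simp add: y1_def mult.commute)
      then show False using divides_in_cancel[OF tf R y0(1), of "?p ^ a" ?p] p0 ndvd by simp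
    qed
  qed
  have "q \<in> ?D y1 \<longleftrightarrow> q \<in> ?D y - {p}" for q
  proof (cases "q = p")
    case True
    then show ?thesis using hp ab(1) by simp
  next
    case False
    then show ?thesis using hq[of q] by auto
  qed
  then have "?D y1 = ?D y - {p}" by blast
  moreover have "card (?D y - {p}) = n" using p fin Suc.hyps(2) by simp
  ultimately have card: "n = card (?D y1)" by simp
  have "same_type R x y1" unfolding same_type_def
  proof (intro conjI allI impI)
    show "finite (?D y1)" using \<open>?D y1 = ?D y - {p}\<close> fin by simp
    fix q assume "prime q \<and> height R q x \<noteq> height R q y1"
    then have q: "q \<in> ?D y" "q \<noteq> p" "prime q" using \<open>?D y1 = ?D y - {p}\<close> by auto
    then show "height R q x \<noteq> \<infinity>" "height R q y1 \<noteq> \<infinity>"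
      using Suc.prems(3) hq[OF q(3,2)] unfolding same_type_def by auto
  qed
  then obtain y' k l where y': "y' \<in> R" "y' \<noteq> 0" "k \<noteq> 0" "l \<noteq> 0" "zmul k y' = zmul l y1"
    "\<forall>m>0. divides_in R (int m) x \<longleftrightarrow> divides_in R (int m) y'"
    using Suc.hyps(1)[OF card y1 \<open>y1 \<noteq> 0\<close>] by blast
  have "zmul (?p ^ b * k) y' = zmul (l * ?p ^ a) y"
    using y'(5) rel by (metis zm.scale_scale zm.scale_left_commute)
  then show ?case using y' p0 by (intro bexI[of _ y'] conjI exI[of _ "?p ^ b * k"] exI[of _ "l * ?p ^ a"]) auto
qed

text \<open>With \<open>u a + v b = g\<close> and \<open>a s = x = b t\<close>, one gets
  \<open>g x = a b (u t + v s)\<close>; torsion-freeness cancels the gcd \<open>g\<close>.\<close>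

lemma divides_in_lcm:
  assumes tf: "torsion_free R" and R: "zm.subspace R" and x: "x \<in> R"
    and ab: "divides_in R a x" "divides_in R b x" "a \<noteq> 0"
  shows "divides_in R (lcm a b) x"
proof -
  define g where "g = gcd a b"
  have g: "g \<noteq> 0" unfolding g_def using ab(3) by simp
  obtain a' b' where a': "a = g * a'" "b = g * b'" unfolding g_def by (meson gcd_dvd1 gcd_dvd2 dvdE)
  obtain u v where "u * a + v * b = g" unfolding g_def using bezout_int by metis
  then have "zmul g x = zmul (u * a) x + zmul (v * b) x" by (metis zm.scale_left_distrib)
  moreover obtain s t where st: "s \<in> R" "t \<in> R" "zmul a s = x" "zmul b t = x"
    using ab(1,2) unfolding divides_in_def by blast
  moreover have "zmul (u * a) x = zmul (a * b) (zmul u t)" using st(4) by (metis zm.scale_scale mult.commute mult.left_commute)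
  moreover have "zmul (v * b) x = zmul (a * b) (zmul v s)" using st(3) by (metis zm.scale_scale mult.commute mult.left_commute)
  ultimately have "zmul g x = zmul (a * b) (zmul u t + zmul v s)" by (simp add: zm.scale_right_distrib)
  moreover have "zmul u t + zmul v s \<in> R" using st(1,2) R by (intro zm.subspace_add zm.subspace_scale)
  ultimately have "divides_in R (a * b) (zmul g x)" unfolding divides_in_def by metis
  moreover have "a * b = g * (a' * b)" using a' by simp
  ultimately have "divides_in R (a' * b) x" using divides_in_cancel[OF tf R x g] by metis
  moreover have "lcm a b dvd a' * b" using a' by (intro lcm_least) auto
  ultimately show ?thesis using divides_in_dvd[OF R] by blast
qed

section \<open>Pure subgroups of homogeneous decomposable groups\<close>

text \<open>The elements \<open>e A\<close> have the same divisors as \<open>x\<close>. If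
  \<open>M\<close> is the set of positive divisors of \<open>x\<close> and \<open>F\<close> the span
  of the \<open>e A\<close>, then \<open>R\<close> consists exactly of the quotients of elements of
  \<open>F\<close> by members of \<open>M\<close>. A splitting of \<open>F\<close> along
  \<open>B \<inter> F\<close> therefore extends to \<open>R\<close> by dividing both
  components.\<close>

lemma homogeneous_decomposable_splitting:
  assumes tf: "torsion_free R" and R: "zm.subspace R" and fd: "fully_decomposable R" and hom: "homogeneous R" and fr: "finite_rank R"
  shows "splitting R"
  unfolding splitting_def
proof (intro conjI allI impI R)
  fix B assume iB: "isolated_in B R"
  then have B: "zm.subspace B" "B \<subseteq> R" and iso: "\<And>x n. x \<in> R \<Longrightarrow> n \<noteq> 0 \<Longrightarrow> zmul n x \<in> B \<Longrightarrow> x \<in> B"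
    unfolding isolated_in_def by auto
  show "\<exists>K. int_dsum R B K"
  proof (cases "R = {0}")
    case True
    then have "B = {0}" using B zm.subspace_0 by blast
    then have "int_dsum R B {0}" unfolding int_dsum_iff using True by auto
    then show ?thesis by blast
  next
    case False
    then obtain x where x: "x \<in> R" "x \<noteq> 0" using R zm.subspace_0 by blast
    obtain \<A> where r1: "\<And>A. A \<in> \<A> \<Longrightarrow> rank_one A" and ds: "internal_direct_sum R \<A>"
      using fd unfolding fully_decomposable_def by blast
    have fin: "finite \<A>" by (rule finite_summands[OF ds r1 fr])
    have AR: "A \<subseteq> R" if "A \<in> \<A>" for A using internal_direct_sum_subset[OF ds that] .
    have "\<exists>e a k l. e \<in> R \<and> e \<noteq> 0 \<and> a \<in> A \<and> a \<noteq> 0 \<and> k \<noteq> 0 \<and> l \<noteq> 0 \<and> zmul k e = zmul l a \<and>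
        (\<forall>m>0. divides_in R (int m) x \<longleftrightarrow> divides_in R (int m) e)" if A: "A \<in> \<A>" for A
    proof -
      obtain a where a: "a \<in> A" "a \<noteq> 0" using r1[OF A] unfolding rank_one_def is_subgroup_def by blast
      then have "a \<in> R" using AR A by blast
      moreover have "same_type R x a" using hom x a \<open>a \<in> R\<close> unfolding homogeneous_def by blast
      ultimately show ?thesis using same_type_adjust[OF tf R x(1) _ a(2)] a by blast
    qed
    then obtain e a k l where e: "\<And>A. A \<in> \<A> \<Longrightarrow> e A \<in> R \<and> e A \<noteq> 0 \<and> a A \<in> A \<and> a A \<noteq> 0 \<and>
        k A \<noteq> (0::int) \<and> l A \<noteq> (0::int) \<and> zmul (k A) (e A) = zmul (l A) (a A) \<and>
        (\<forall>m>0. divides_in R (int m) x \<longleftrightarrow> divides_in R (int m) (e A))" by metis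
    define F where "F = zm.span (e ` \<A>)"
    have F: "zm.subspace F" unfolding F_def by simp
    have eF: "e A \<in> F" if "A \<in> \<A>" for A unfolding F_def using that by (intro zm.span_base) auto
    have FR: "F \<subseteq> R" unfolding F_def using e R by (intro zm.span_minimal) auto
    define M where "M = {m. m > 0 \<and> divides_in R m x}"
    have Mint: "divides_in R m (e A)" if "m \<in> M" "A \<in> \<A>" for m A
      using e[OF that(2)] that(1) unfolding M_def by (metis (mono_tags, lifting) mem_Collect_eq zero_less_imp_eq_int)
    have MF: "divides_in R m f" if m: "m \<in> M" and f: "f \<in> F" for m f
      using f unfolding F_def
    proof (induction rule: zm.span_induct_alt)
      case base
      have "zmul m 0 = 0" by simp
      then show ?case unfolding divides_in_def using zm.subspace_0[OF R] by blast
    next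
      case (step c z y)
      then show ?case using divides_in_add[OF R] divides_in_zmul[OF R] Mint[OF m] by blast
    qed
    \<comment> \<open>\<open>W\<close> is closed under addition because \<open>M\<close> is closed
      under least common multiples; it remains to see that each rank-one summand lies in
      \<open>W\<close>.\<close>
    define W where "W = {z\<in>R. \<exists>m\<in>M. zmul m z \<in> F}"
    have "1 \<in> M" unfolding M_def divides_in_def using x(1) by auto
    have W: "zm.subspace W"
    proof (rule zm.subspaceI)
      show "0 \<in> W" unfolding W_def using \<open>1 \<in> M\<close> zm.subspace_0 R F by force
    next
      fix y z assume "y \<in> W" "z \<in> W"
      then obtain m n where mn: "y \<in> R" "z \<in> R" "m \<in> M" "n \<in> M" "zmul m y \<in> F" "zmul n z \<in> F"
        unfolding W_def by blast
      have "lcm m n \<in> M" using mn(3,4) divides_in_lcm[OF tf R x(1), of m n] unfolding M_def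
        by (auto simp: lcm_pos_int)
      obtain i j where ij: "lcm m n = i * m" "lcm m n = j * n" by (metis dvd_lcm1 dvd_lcm2 dvdE mult.commute)
      have "zmul (lcm m n) y = zmul i (zmul m y)" "zmul (lcm m n) z = zmul j (zmul n z)"
        using ij by (metis zm.scale_scale)+
      then have "zmul (lcm m n) (y + z) \<in> F"
        using mn(5,6) F by (metis zm.scale_right_distrib zm.subspace_add zm.subspace_scale)
      then show "y + z \<in> W" unfolding W_def using \<open>lcm m n \<in> M\<close> zm.subspace_add[OF R mn(1,2)] by blast
    next
      fix y c assume "y \<in> W"
      then obtain m where m: "y \<in> R" "m \<in> M" "zmul m y \<in> F" unfolding W_def by blast
      have "zmul m (zmul c y) = zmul c (zmul m y)" by (rule zm.scale_left_commute)
      then have "zmul m (zmul c y) \<in> F" using zm.subspace_scale[OF F m(3)] by simp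
      then show "zmul c y \<in> W" unfolding W_def using m zm.subspace_scale[OF R m(1)] by blast
    qed
    have AW: "A \<subseteq> W" if A: "A \<in> \<A>" for A
    proof
      fix z assume z: "z \<in> A"
      have zR: "z \<in> R" using z AR A by blast
      obtain i j where ij: "i \<noteq> 0" "zmul i z = zmul j (a A)"
        using rank_one_dependent[OF r1[OF A], of "a A" z] e[OF A] z by blast
      define s t where "s = l A * i" and "t = j * k A"
      have s0: "s \<noteq> 0" unfolding s_def using e[OF A] ij by simp
      have "zmul s z = zmul (l A) (zmul j (a A))" unfolding s_def ij(2)[symmetric] by simp
      also have "\<dots> = zmul j (zmul (l A) (a A))" by (rule zm.scale_left_commute)
      also have "\<dots> = zmul t (e A)" unfolding t_def using e[OF A] by (metis zm.scale_scale)
      finally have st: "zmul s z = zmul t (e A)" .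
      \<comment> \<open>The relation \<open>s z = t e\<close> is brought to lowest terms
        \<open>s' z = t' e\<close>. By coprimality \<open>s'\<close> divides \<open>e A\<close>, so
        its absolute value belongs to \<open>M\<close>.\<close>
      define g where "g = gcd s t"
      have g: "g \<noteq> 0" unfolding g_def using s0 by simp
      obtain s' t' where s': "s = g * s'" "t = g * t'" unfolding g_def by (meson gcd_dvd1 gcd_dvd2 dvdE)
      have cop: "coprime s' t'" using s' g_def s0 g
        by (metis div_gcd_coprime nonzero_mult_div_cancel_left)
      have eR: "e A \<in> R" using e[OF A] by blast
      have "zmul g (zmul s' z) = zmul g (zmul t' (e A))" using st s' by simp
      then have eq: "zmul s' z = zmul t' (e A)"
        by (rule torsion_free_cancel[OF tf R zm.subspace_scale[OF R zR] zm.subspace_scale[OF R eR] g])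
      then have "divides_in R s' (zmul t' (e A))" unfolding divides_in_def using zR by blast
      then have "divides_in R s' (e A)" using divides_in_cancel_coprime[OF R eR cop] by blast
      then have "divides_in R \<bar>s'\<bar> (e A)" using divides_in_dvd[OF R] by (metis abs_dvd_iff dvd_refl)
      moreover have "s' \<noteq> 0" using s0 s' by auto
      ultimately have "\<bar>s'\<bar> \<in> M" unfolding M_def using e[OF A]
        by (metis (mono_tags, lifting) mem_Collect_eq zero_less_abs_iff zero_less_imp_eq_int)
      moreover have "zmul \<bar>s'\<bar> z \<in> F"
      proof -
        have "zmul s' z \<in> F" unfolding eq using zm.subspace_scale[OF F eF[OF A]] .
        then show ?thesis using zm.subspace_neg[OF F] by (auto simp: abs_if)
      qed
      ultimately show "z \<in> W" unfolding W_def using zR by blast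
    qed
    have RW: "R \<subseteq> W"
    proof
      fix z assume "z \<in> R"
      then obtain G y where G: "z = (\<Sum>A\<in>G. y A)" "G \<subseteq> \<A>" "\<forall>A\<in>G. y A \<in> A"
        using ds unfolding internal_direct_sum_def by blast
      then show "z \<in> W" unfolding G(1) using AW by (intro zm.subspace_sum[OF W]) blast
    qed
    have "isolated_in (B \<inter> F) F" unfolding isolated_in_def using B F iso FR zm.subspace_inter[OF B(1) F] by blast
    moreover have "F = zm.span (B \<inter> F \<union> e ` \<A>)"
    proof
      show "F \<subseteq> zm.span (B \<inter> F \<union> e ` \<A>)" unfolding F_def by (intro zm.span_mono) auto
      show "zm.span (B \<inter> F \<union> e ` \<A>) \<subseteq> F" using F eF by (intro zm.span_minimal) auto
    qed
    ultimately obtain K0 where K0: "int_dsum F (B \<inter> F) K0"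
      using finitely_generated_summand[of "e ` \<A>" "B \<inter> F" F] fin F by blast
    let ?K = "isolator R K0"
    have "int_dsum R B ?K" unfolding int_dsum_iff
    proof (intro conjI ballI)
      show "zm.subspace ?K" by (rule subspace_isolator[OF R int_dsumD(3)[OF K0]])
      show "?K \<subseteq> R" unfolding isolator_def by blast
      show "B \<inter> ?K \<subseteq> {0}"
      proof
        fix z assume z: "z \<in> B \<inter> ?K"
        then obtain n where n: "n \<noteq> 0" "zmul n z \<in> K0" unfolding isolator_def by blast
        then have "zmul n z \<in> B \<inter> F" using z B zm.subspace_scale int_dsumD(5)[OF K0] by blast
        then have "zmul n z = 0" using int_dsumD(6)[OF K0] n(2) by blast
        then show "z \<in> {0}" using torsion_freeD[OF tf] z B(2) n(1) by blast
      qed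
      fix z assume z: "z \<in> R"
      then obtain m where m: "m \<in> M" "zmul m z \<in> F" using RW unfolding W_def by blast
      have m0: "m \<noteq> 0" using m(1) unfolding M_def by auto
      obtain b c where bc: "b \<in> B \<inter> F" "c \<in> K0" "zmul m z = b + c" using int_dsumD(7)[OF K0 m(2)] by blast
      \<comment> \<open>\<open>m z\<close> splits in \<open>F\<close>; since \<open>m\<close> is in
        \<open>M\<close>, both components can be divided by \<open>m\<close> inside
        \<open>R\<close>.\<close>
      obtain b' where b': "b' \<in> R" "zmul m b' = b" using MF[OF m(1)] bc(1) unfolding divides_in_def by blast
      have "c \<in> F" using bc(2) int_dsumD(5)[OF K0] by blast
      then obtain c' where c': "c' \<in> R" "zmul m c' = c" using MF[OF m(1)] unfolding divides_in_def by blast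
      have "b' \<in> B" using iso[OF b'(1) m0] b'(2) bc(1) by blast
      moreover have "c' \<in> ?K" unfolding isolator_def using c' bc(2) m0 by blast
      moreover have "zmul m z = zmul m (b' + c')" using bc(3) b'(2) c'(2) by (simp add: zm.scale_right_distrib)
      then have "z = b' + c'" using torsion_free_cancel[OF tf R z zm.subspace_add[OF R b'(1) c'(1)] m0] by blast
      ultimately show "\<exists>b\<in>B. \<exists>c\<in>?K. z = b + c" by blast
    qed (use B R in auto)
    then show ?thesis by blast
  qed
qed

section \<open>Essential extensions of arbitrary subgroups\<close>

text \<open>With \<open>E\<close> the divisible hull of \<open>H \<inter> D\<close>, the group
  \<open>?H1 = H + E\<close> is \<open>E \<oplus> ?H2\<close> with \<open>?H2\<close> meeting
  \<open>D\<close> trivially, so some complement \<open>R2\<close> of \<open>D\<close> contains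
  \<open>?H2\<close>. The part in \<open>R2\<close> of the isolator of \<open>D + ?H2\<close> is a
  summand \<open>?P\<close>, and \<open>H\<close> is essential in
  \<open>E \<oplus> ?P\<close>.\<close>

lemma splitting_extending:
  fixes D H :: "'a::ab_group_add set"
  assumes DR: "int_dsum UNIV D R" and D: "divisible D" and tf: "torsion_free R" and spl: "splitting R"
    and H: "zm.subspace H"
  shows "\<exists>S. direct_summand S \<and> essential_in H S"
proof -
  note * = int_dsumD[OF DR]
  have torsion: "z \<in> D" if z: "n \<noteq> 0" "zmul n z = 0" for z n
  proof -
    obtain d r where dr: "d \<in> D" "r \<in> R" "z = d + r" using *(7)[of z] by auto
    have "zmul n d + zmul n r = 0" using z(2) dr by (simp add: zm.scale_right_distrib)
    then have "zmul n r = 0"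
      using int_dsum_zero(2)[OF DR zm.subspace_scale[OF *(2) dr(1)] zm.subspace_scale[OF *(3) dr(2)]] by blast
    then have "r = 0" using torsion_freeD[OF tf dr(2)] z(1) by blast
    then show ?thesis using dr by simp
  qed
  have X: "zm.subspace (H \<inter> D)" by (rule zm.subspace_inter[OF H *(2)])
  obtain E where E: "zm.subspace E" "divisible E" "E \<subseteq> D" and XE: "essential_in (H \<inter> D) E"
    using divisible_hull[OF *(2) D X] by blast
  have XsE: "H \<inter> D \<subseteq> E" using XE unfolding essential_in_def by blast
  let ?H1 = "set_add H E"
  have H1: "zm.subspace ?H1" by (rule subspace_set_add[OF H E(1)])
  have HE: "H \<subseteq> ?H1" "E \<subseteq> ?H1" by (rule subset_set_add[OF H E(1)])+
  \<comment> \<open>\<open>E\<close> is all of \<open>?H1 \<inter> D\<close>: the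
    \<open>H\<close>-part of such an element lies in \<open>H \<inter> D\<close>, which is contained
    in \<open>E\<close>.\<close>
  have H1D: "z \<in> E" if z: "z \<in> ?H1" "z \<in> D" for z
  proof -
    obtain h e where he: "h \<in> H" "e \<in> E" "z = h + e" using z(1) by (elim set_addE)
    then have "h = z - e" by simp
    then have "h \<in> D" using z(2) he(2) E(3) *(2) zm.subspace_diff by blast
    then have "h \<in> E" using he(1) XsE by blast
    then show ?thesis using he E(1) zm.subspace_add by blast
  qed
  have essE: "\<exists>k. zmul k z \<in> H \<and> zmul k z \<noteq> 0" if "z \<in> E" "z \<noteq> 0" for z
    using essential_in_iff[OF X E(1)] XE that by blast
  have ess1: "\<exists>k. zmul k z \<in> H \<and> zmul k z \<noteq> 0" if z: "z \<in> ?H1" "z \<noteq> 0" for z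
  proof -
    obtain h e where he: "h \<in> H" "e \<in> E" "z = h + e" using z(1) by (elim set_addE)
    obtain k where k: "k \<noteq> 0" "zmul k e \<in> H \<inter> D" using essential_inD[OF XE X E(1) he(2)] by blast
    have kz: "zmul k z \<in> H"
      unfolding he(3) zm.scale_right_distrib using k(2) zm.subspace_add[OF H] zm.subspace_scale[OF H he(1)] by blast
    show ?thesis
    proof (cases "zmul k z = 0")
      \<comment> \<open>Here \<open>z\<close> is torsion, so it lies in \<open>D\<close> and hence
        in \<open>E\<close>, where \<open>H \<inter> D\<close> is essential.\<close>
      case True
      then show ?thesis using torsion[OF k(1)] H1D z essE by blast
    qed (use kz in blast)
  qed
  have "zm.subspace {0::'a}" by simp
  then obtain G1 where EG: "int_dsum UNIV E G1" using divisible_complement[OF E(1,2)] by blast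
  have H2: "int_dsum ?H1 E (?H1 \<inter> G1)" by (rule int_dsum_modular[OF EG H1 HE(2)]) simp
  have D': "int_dsum D E (D \<inter> G1)" by (rule int_dsum_modular[OF EG *(2) E(3)]) simp
  let ?H2 = "?H1 \<inter> G1"
  have "D \<inter> ?H2 \<subseteq> {0}" using H1D int_dsumD(6)[OF EG] by blast
  then obtain R2 where R2: "?H2 \<subseteq> R2" and DR2: "int_dsum UNIV D R2"
    using divisible_complement[OF *(2) D int_dsumD(3)[OF H2]] by blast
  \<comment> \<open>The splitting property is available for \<open>R\<close>, while
    \<open>?H2\<close> sits in the other complement \<open>R2\<close>. As \<open>?Q\<close> contains
    \<open>D\<close>, a complement of \<open>?Q \<inter> R\<close> in \<open>R\<close> is a
    complement of \<open>?Q\<close> in the whole group.\<close>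
  let ?Q = "isolator UNIV (set_add D ?H2)"
  have DH2: "zm.subspace (set_add D ?H2)" by (rule subspace_set_add[OF *(2) int_dsumD(3)[OF H2]])
  have isoQ: "isolated_in ?Q UNIV" by (rule isolated_isolator[OF *(1) DH2])
  then have Q: "zm.subspace ?Q" unfolding isolated_in_def by blast
  have subQ: "D \<subseteq> ?Q" "?H2 \<subseteq> ?Q"
    using isolator_superset[of "set_add D ?H2" UNIV] subset_set_add[OF *(2) int_dsumD(3)[OF H2]] by auto
  have "isolated_in (?Q \<inter> R) R"
    using isoQ zm.subspace_inter[OF Q *(3)] unfolding isolated_in_def by blast
  then obtain K where K: "int_dsum R (?Q \<inter> R) K" using spl unfolding splitting_def by blast
  have QK: "int_dsum UNIV ?Q K" unfolding int_dsum_iff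
  proof (intro conjI ballI)
    show "?Q \<inter> K \<subseteq> {0}" using int_dsumD(5,6)[OF K] by blast
    fix z :: 'a
    obtain d r where dr: "d \<in> D" "r \<in> R" "z = d + r" using *(7)[of z] by auto
    obtain q c where qc: "q \<in> ?Q \<inter> R" "c \<in> K" "r = q + c" using int_dsumD(7)[OF K dr(2)] by blast
    have "d + q \<in> ?Q" using dr(1) qc(1) subQ(1) zm.subspace_add[OF Q] by blast
    moreover have "z = (d + q) + c" using dr qc by (simp add: algebra_simps)
    ultimately show "\<exists>b\<in>?Q. \<exists>c\<in>K. z = b + c" using qc(2) by blast
  qed (use Q int_dsumD(3)[OF K] in auto)
  let ?P = "?Q \<inter> R2"
  have DP: "int_dsum ?Q D ?P" by (rule int_dsum_modular[OF DR2 Q subQ(1)]) simp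
  let ?S = "set_add E ?P"
  have "int_dsum ?Q ?S (D \<inter> G1)" by (rule int_dsum_commute[OF int_dsum_assoc[OF DP int_dsum_commute[OF D']]])
  then have S: "int_dsum UNIV ?S (set_add (D \<inter> G1) K)" by (rule int_dsum_assoc[OF QK])
  have P: "zm.subspace ?P" by (rule int_dsumD(3)[OF DP])
  have "essential_in H ?S" unfolding essential_in_iff[OF H int_dsumD(2)[OF S]]
  proof (intro conjI ballI impI)
    show "H \<subseteq> ?S"
    proof
      fix h assume "h \<in> H"
      then obtain e c where "e \<in> E" "c \<in> ?H2" "h = e + c" using int_dsumD(7)[OF H2] HE(1) by blast
      then show "h \<in> ?S" using subQ(2) R2 set_addI by blast
    qed
    fix z assume z: "z \<in> ?S" "z \<noteq> 0"
    then obtain e s where es: "e \<in> E" "s \<in> ?P" "z = e + s" by (elim set_addE)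
    \<comment> \<open>Some multiple \<open>n s\<close> lies in \<open>D + ?H2\<close> and in
      \<open>R2\<close>; as \<open>?H2\<close> is contained in \<open>R2\<close>, its
      \<open>D\<close>-part vanishes. Thus \<open>n z\<close> lies in \<open>?H1\<close>, where
      \<open>H\<close> is essential.\<close>
    obtain n where n: "n \<noteq> 0" "zmul n s \<in> set_add D ?H2" using es(2) unfolding isolator_def by blast
    obtain d c where dc: "d \<in> D" "c \<in> ?H2" "zmul n s = d + c" using n(2) by (elim set_addE)
    have nsR2: "zmul n s \<in> R2" using es(2) zm.subspace_scale[OF int_dsumD(3)[OF DR2]] by blast
    have "0 + zmul n s = d + c" using dc by simp
    then have "zmul n s = c"
      using int_dsum_unique(2)[OF DR2 zm.subspace_0[OF *(2)] dc(1) nsR2] dc(2) R2 by blast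
    then have ns: "zmul n s \<in> ?H1" using dc(2) by blast
    have nz: "zmul n z \<in> ?H1"
      unfolding es(3) zm.scale_right_distrib
      using zm.subspace_add[OF H1] zm.subspace_scale[OF E(1) es(1)] HE(2) ns by blast
    show "\<exists>k. zmul k z \<in> H \<and> zmul k z \<noteq> 0"
    proof (cases "zmul n z = 0")
      case False
      then obtain k where "zmul k (zmul n z) \<in> H" "zmul k (zmul n z) \<noteq> 0" using ess1[OF nz] by blast
      then show ?thesis by (metis zm.scale_scale)
    next
      \<comment> \<open>If \<open>n z = 0\<close>, then \<open>z\<close> is in \<open>D\<close>, so
        \<open>s\<close> is in \<open>D \<inter> R2\<close> and vanishes; \<open>z\<close> lies in
        \<open>E\<close>.\<close>
      case True
      then have "z \<in> D" by (rule torsion[OF n(1)])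
      then have "z - e \<in> D" using es(1) E(3) zm.subspace_diff[OF *(2)] by blast
      then have "s \<in> D" using es(3) by simp
      then have "s = 0" using es(2) int_dsumD(6)[OF DR2] by blast
      then show ?thesis using es z(2) essE by simp
    qed
  qed
  then show ?thesis unfolding direct_summand_def using S by blast
qed

section \<open>The equivalence and the semi-generalized Bassian property\<close>

theorem theorem2p17:
  assumes "mixed (UNIV :: 'a::ab_group_add set) \<or> torsion_free (UNIV :: 'a set)"
  shows "((\<forall>H::'a set. is_subgroup H \<longrightarrow> (\<exists>S. direct_summand S \<and> essential_in H S))
          \<longleftrightarrow>
          (\<exists>D R D0. int_dsum (UNIV :: 'a set) D R \<and> divisible D \<and>
             int_dsum D (torsion_part D) D0 \<and> torsion_free D0 \<and>
             torsion_free R \<and> fully_decomposable R \<and> homogeneous R \<and> finite_rank R))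
       \<and> ((\<exists>D R D0. int_dsum (UNIV :: 'a set) D R \<and> divisible D \<and>
             int_dsum D (torsion_part D) D0 \<and> torsion_free D0 \<and>
             torsion_free R \<and> fully_decomposable R \<and> homogeneous R \<and> finite_rank R)
          \<longrightarrow> semi_generalized_bassian TYPE('a))"
    (is "(?ext \<longleftrightarrow> ?dec) \<and> (?dec \<longrightarrow> ?sgb)")
proof -
  have backward: ?ext if dec: ?dec
  proof (intro allI impI)
    fix H :: "'a set" assume H: "is_subgroup H"
    obtain D R where DR: "int_dsum (UNIV :: 'a set) D R" "divisible D" "torsion_free R"
      "fully_decomposable R" "homogeneous R" "finite_rank R" using dec by blast
    have "splitting R"
      by (rule homogeneous_decomposable_splitting[OF DR(3) int_dsumD(3)[OF DR(1)] DR(4-6)])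
    then show "\<exists>S. direct_summand S \<and> essential_in H S"
      using splitting_extending[OF DR(1-3)] H is_subgroup_iff by blast
  qed
  have forward: ?dec if ?ext
  proof -
    have ext: "\<exists>S. direct_summand S \<and> essential_in H S" if "zm.subspace H" for H :: "'a set"
      using \<open>?ext\<close> that is_subgroup_iff by blast
    have "divisible (torsion_part (UNIV :: 'a set))"
    proof (cases "\<exists>s::'a. \<not> has_finite_order s")
      case True
      then show ?thesis using divisible_torsion[OF ext] by blast
    next
      \<comment> \<open>Without elements of infinite order the group is not mixed, so it is
        torsion-free and its torsion part is zero.\<close>
      case False
      then have "torsion_free (UNIV :: 'a set)" using assms unfolding mixed_def by blast
      then have "torsion_part (UNIV :: 'a set) \<subseteq> {0}" unfolding torsion_free_def torsion_part_def by blast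
      then show ?thesis unfolding divisible_def by (metis nmul_eq_zmul singletonD subsetD zm.scale_zero_right)
    qed
    then obtain D D0 R :: "'a set" where "int_dsum UNIV D R" "divisible D" "int_dsum D (torsion_part D) D0"
      "torsion_free D0" "torsion_free R" "reduced R" "splitting R"
      using extending_decomposition[OF ext] by blast
    then show ?dec using splitting_reduced_decomposable[of R] splitting_homogeneous[of R] by blast
  qed
  have ?sgb if ?dec
    using backward[OF that] unfolding semi_generalized_bassian_def by blast
  then show ?thesis using backward forward by blast
qed

end
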